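(* Let $n>2$ and $w \in \mathfrak{S}_n$ with $\{w(1),\ldots,w(r)\}\ne\{1,\ldots,r\}$ for all $r<n$. Then every rhombic tiling of $X(w)$ has exactly two side-perimeter tiles if and only if, for some $k\in[n-1]$, $w$ has the one-line form $$(k+1)(k+2)\cdots n\,1\,2\cdots k \quad\text{or}\quad (k+1)(k+2)\cdots n\,k\,1\,2\cdots(k-1).$$
   Context: Elnitsky's polygon $X(w)$: starting at the top vertex, label the sides $1,\ldots,n,w(n),\ldots,w(1)$ counterclockwise; sides $1,\dots,n$ (the leftside boundary, top to bottom) form half of a convex $2n$-gon; the remaining sides (the rightside boundary) are drawn so that sides are parallel and congruent iff equally labeled. A rhombic tiling is a tiling of $X(w)$ by rhombi whose edges are congruent and parallel to edges of $X(w)$. A left-perimeter (right-perimeter) tile is a tile containing two edges of the leftside (rightside) boundary; side-perimeter tiles are tiles that are left- or right-perimeter tiles. *)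

theory Defs
  imports "HOL-Analysis.Analysis" "HOL-Combinatorics.Permutations"
begin

text \<open>
  Elnitsky's polygon is drawn in the complex plane with its top vertex at the origin and with sides
  of length 1. (All sides must have the same length, since the tiles are rhombi.) The number
  \<open>\<theta> i\<close> is the argument of the side labelled \<open>i\<close>, directed downwards. Sides
  \<open>1, \<dots>, n\<close>, traversed from the top vertex, and then again the same sides reversed, bound
  a convex \<open>2 * n\<close>-gon lying to their left (so that the first half is its left boundary)
  precisely if the arguments are strictly increasing within a half turn.
\<close>

definition half_convex_polygon :: "nat \<Rightarrow> (nat \<Rightarrow> real) \<Rightarrow> bool" where
  "half_convex_polygon n \<theta> \<longleftrightarrow>
     strict_mono_on {1..n} \<theta> \<and> (\<forall>i\<in>{1..n}. pi < \<theta> i \<and> \<theta> i < 2 * pi)"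

definition side_vector :: "(nat \<Rightarrow> real) \<Rightarrow> nat \<Rightarrow> complex" where
  "side_vector \<theta> i = cis (\<theta> i)"

text \<open>
  Downwards from the top vertex, the sides on the left are labelled \<open>1, \<dots>, n\<close> and those on the
  right \<open>w 1, \<dots>, w n\<close>; thus the left boundary is the case \<open>w = id\<close> of the following.
\<close>

definition path_vertex :: "(nat \<Rightarrow> real) \<Rightarrow> (nat \<Rightarrow> nat) \<Rightarrow> nat \<Rightarrow> complex" where
  "path_vertex \<theta> w k = (\<Sum>i=1..k. side_vector \<theta> (w i))"

definition path_side :: "(nat \<Rightarrow> real) \<Rightarrow> (nat \<Rightarrow> nat) \<Rightarrow> nat \<Rightarrow> complex set" where
  "path_side \<theta> w k = closed_segment (path_vertex \<theta> w (k - 1)) (path_vertex \<theta> w k)"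

definition left_side :: "(nat \<Rightarrow> real) \<Rightarrow> nat \<Rightarrow> complex set" where
  "left_side \<theta> = path_side \<theta> id"

definition right_side :: "(nat \<Rightarrow> real) \<Rightarrow> (nat \<Rightarrow> nat) \<Rightarrow> nat \<Rightarrow> complex set" where
  "right_side \<theta> w = path_side \<theta> w"

definition elnitsky_boundary :: "nat \<Rightarrow> (nat \<Rightarrow> real) \<Rightarrow> (nat \<Rightarrow> nat) \<Rightarrow> complex set" where
  "elnitsky_boundary n \<theta> w = (\<Union>k\<in>{1..n}. left_side \<theta> k) \<union> (\<Union>k\<in>{1..n}. right_side \<theta> w k)"

definition elnitsky_polygon :: "nat \<Rightarrow> (nat \<Rightarrow> real) \<Rightarrow> (nat \<Rightarrow> nat) \<Rightarrow> complex set" where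
  "elnitsky_polygon n \<theta> w = elnitsky_boundary n \<theta> w \<union> inside (elnitsky_boundary n \<theta> w)"

definition edge_vectors :: "nat \<Rightarrow> (nat \<Rightarrow> real) \<Rightarrow> complex set" where
  "edge_vectors n \<theta> = (\<Union>i\<in>{1..n}. {side_vector \<theta> i, - side_vector \<theta> i})"

text \<open>
  A segment is congruent and parallel to a side of the polygon iff the difference of its endpoints
  is an edge vector. All edge vectors have norm 1, so \<open>u \<noteq> v\<close> and \<open>u \<noteq> - v\<close> say that the rhombus
  is not degenerate.
\<close>

definition rhombic_tile :: "nat \<Rightarrow> (nat \<Rightarrow> real) \<Rightarrow> complex set \<Rightarrow> bool" where
  "rhombic_tile n \<theta> R \<longleftrightarrow>
     (\<exists>a. \<exists>u\<in>edge_vectors n \<theta>. \<exists>v\<in>edge_vectors n \<theta>.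
        u \<noteq> v \<and> u \<noteq> - v \<and> R = convex hull {a, a + u, a + u + v, a + v})"

definition rhombic_tiling ::
    "nat \<Rightarrow> (nat \<Rightarrow> real) \<Rightarrow> (nat \<Rightarrow> nat) \<Rightarrow> complex set set \<Rightarrow> bool" where
  "rhombic_tiling n \<theta> w T \<longleftrightarrow>
     finite T \<and> (\<forall>R\<in>T. rhombic_tile n \<theta> R) \<and>
     pairwise (\<lambda>R S. interior R \<inter> interior S = {}) T \<and>
     \<Union>T = elnitsky_polygon n \<theta> w"

definition left_perimeter_tile :: "nat \<Rightarrow> (nat \<Rightarrow> real) \<Rightarrow> complex set \<Rightarrow> bool" where
  "left_perimeter_tile n \<theta> R \<longleftrightarrow>
     (\<exists>i\<in>{1..n}. \<exists>j\<in>{1..n}. i \<noteq> j \<and> left_side \<theta> i \<subseteq> R \<and> left_side \<theta> j \<subseteq> R)"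

definition right_perimeter_tile ::
    "nat \<Rightarrow> (nat \<Rightarrow> real) \<Rightarrow> (nat \<Rightarrow> nat) \<Rightarrow> complex set \<Rightarrow> bool" where
  "right_perimeter_tile n \<theta> w R \<longleftrightarrow>
     (\<exists>i\<in>{1..n}. \<exists>j\<in>{1..n}. i \<noteq> j \<and> right_side \<theta> w i \<subseteq> R \<and> right_side \<theta> w j \<subseteq> R)"

definition side_perimeter_tiles ::
    "nat \<Rightarrow> (nat \<Rightarrow> real) \<Rightarrow> (nat \<Rightarrow> nat) \<Rightarrow> complex set set \<Rightarrow> complex set set" where
  "side_perimeter_tiles n \<theta> w T =
     {R \<in> T. left_perimeter_tile n \<theta> R \<or> right_perimeter_tile n \<theta> w R}"

definition one_line :: "nat \<Rightarrow> (nat \<Rightarrow> nat) \<Rightarrow> nat list" where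
  "one_line n w = map w [1..<n + 1]"

end

theory Submission imports Defs begin

text \<open>
  Everything is read off horizontal slices. The directed sides all point downwards, so the path of a
  permutation \<open>u\<close> is the graph of a function of the depth, \<open>X(w)\<close> is the region between the graphs of
  the identity and of \<open>w\<close>, and a tile is the region between its left and its right contour. In a
  family of tiles with disjoint interiors some tile has no tile to its left. If the family tiles the
  region between the paths of \<open>u\<close> and \<open>w\<close>, the left contour of that tile runs along the path of \<open>u\<close>;
  it then consists of two consecutive sides \<open>u p < u (p + 1)\<close>, and removing the tile leaves a tiling of
  the region between \<open>u\<close> with these two entries exchanged and \<open>w\<close>. Hence tilings are recorded by
  chains in the weak order from the identity to \<open>w\<close>: the labels of every tile form an inversion of
  \<open>w\<close>, the first tile of a chain is a left-perimeter tile and the last one a right-perimeter tile.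
  So right-perimeter (left-perimeter) tiles sit at descents of \<open>w\<close> (of its inverse), two of
  them cannot sit at adjacent descents, and any two non-adjacent descents do occur together in some
  tiling. The condition on all tilings thus says that neither \<open>w\<close> nor its inverse has two
  non-adjacent descents, and the indecomposable permutations of this kind are the two families.
\<close>

section \<open>Permutations with clustered descents\<close>

text \<open>A tiling is only a set of point sets, so an order of removal has to be found.
  \<open>left_of\<close> compares only tiles that share a depth and need not be transitive; hence
  the existence of a tile with nothing to its left is itself a geometric fact, proved by continuity
  of the contours and a sweep from top to bottom. A second obstacle is pinching: the paths of an
  intermediate \<open>u\<close> and of \<open>w\<close> may touch or run together at many depths.
  Coverage is therefore demanded only strictly between the paths, a condition that survives both
  removal and concatenation, and full closed regions are recovered by closures for the polygon
  itself. Irreducibility of \<open>w\<close> enters three times. It keeps the two boundaries apart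
  except at the top and bottom vertices, so that the polygon has no degenerate slices; together with
  \<open>n > 2\<close> it prevents a tile from being perimeter on both sides; and in the
  combinatorial part it moves the values \<open>1\<close> and \<open>n\<close> away from their own
  positions, which fixes where descents sit.\<close>

lemma strict_mono_stepI:
  fixes f :: "nat \<Rightarrow> nat"
  assumes step: "\<And>k. a \<le> k \<Longrightarrow> k < b \<Longrightarrow> f k < f (Suc k)"
    and "a \<le> x" "x \<le> y" "y \<le> b"
  shows "f x + (y - x) \<le> f y"
  using assms(3,4)
proof (induction y rule: dec_induct)
  case (step m)
  then show ?case using assms(1)[of m] assms(2) by auto
qed auto

text \<open>The increase from \<open>1\<close> to \<open>x\<close> gives \<open>x \<le> f x\<close>,
  the one from \<open>x\<close> to \<open>n\<close> gives \<open>f x \<le> x\<close>.\<close>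

lemma increasing_permutation_eq_id:
  fixes f :: "nat \<Rightarrow> nat"
  assumes "f permutes {1..n}" and "\<And>k. k \<in> {1..<n} \<Longrightarrow> f k < f (Suc k)"
  shows "f = id"
proof
  fix x show "f x = id x"
  proof (cases "x \<in> {1..n}")
    case True
    then have "f 1 \<in> {1..n}" "f n \<in> {1..n}" using permutes_in_image[OF assms(1)] by auto
    then show ?thesis
      using strict_mono_stepI[of 1 n f 1 x] strict_mono_stepI[of 1 n f x n] assms(2) True by force
  next
    case False
    then show ?thesis using assms(1) by (simp add: permutes_not_in)
  qed
qed

text \<open>The one-sided bound is imposed on all ordered pairs, so any two descents differ by at
  most 1. Hence there are at most two descents, and two of them are adjacent.\<close>

definition clustered_descents :: "nat \<Rightarrow> (nat \<Rightarrow> nat) \<Rightarrow> bool" where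
  "clustered_descents n f \<longleftrightarrow> (\<forall>p\<in>{1..<n}. \<forall>q\<in>{1..<n}. f (Suc p) < f p \<longrightarrow> f (Suc q) < f q \<longrightarrow> q \<le> Suc p)"

text \<open>With \<open>p\<close> the least descent, the only other candidate is
  \<open>Suc p\<close>. So there are two increasing runs, on positions up to \<open>p\<close> and
  from \<open>p + 2\<close> on; the step out of \<open>Suc p\<close> remains undetermined.\<close>

lemma clustered_descents_runs:
  assumes f: "f permutes {1..n}" "f \<noteq> id" and cl: "clustered_descents n f"
  obtains p where "p \<in> {1..<n}" "f (Suc p) < f p"
    "\<And>k. 1 \<le> k \<Longrightarrow> k < p \<Longrightarrow> f k < f (Suc k)"
    "\<And>k. Suc (Suc p) \<le> k \<Longrightarrow> k < n \<Longrightarrow> f k < f (Suc k)"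
proof -
  have ne: "f k \<noteq> f (Suc k)" for k using permutes_inj[OF f(1)] by (metis injD n_not_Suc_n)
  have "\<exists>p. p \<in> {1..<n} \<and> f (Suc p) < f p"
  proof (rule ccontr)
    assume "\<not> ?thesis"
    then have "f k < f (Suc k)" if "k \<in> {1..<n}" for k using ne[of k] that
      by (meson linorder_neqE_nat)
    then show False using increasing_permutation_eq_id[OF f(1)] f(2) by blast
  qed
  note ex = this
  define p where "p = (LEAST p. p \<in> {1..<n} \<and> f (Suc p) < f p)"
  have p: "p \<in> {1..<n}" "f (Suc p) < f p" using LeastI_ex[OF ex] by (auto simp: p_def)
  have "f k < f (Suc k)" if "1 \<le> k" "k < p" for k
  proof -
    have "\<not> (k \<in> {1..<n} \<and> f (Suc k) < f k)" using that(2) unfolding p_def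
      by (rule not_less_Least)
    then show ?thesis using that p(1) ne[of k] by auto
  qed
  moreover have "f k < f (Suc k)" if "Suc (Suc p) \<le> k" "k < n" for k
  proof -
    have "k \<in> {1..<n}" using that by auto
    then have "\<not> f (Suc k) < f k" using cl p that unfolding clustered_descents_def
      by (meson not_less_eq_eq)
    then show ?thesis using ne[of k] by simp
  qed
  ultimately show ?thesis using that p by blast
qed

text \<open>The run structure of \<open>w\<close> and that of its inverse \<open>v\<close> determine
  each other. With first descents \<open>p\<close> and \<open>i\<close>, irreducibility forces
  \<open>w p = n\<close> and \<open>v i = n\<close>, while \<open>v 1\<close> is
  \<open>p + 1\<close> or \<open>p + 2\<close> and \<open>w 1\<close> is \<open>i + 1\<close> or
  \<open>i + 2\<close>. The mixed choices are contradictory; the two matching ones give the two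
  families, with \<open>k = i\<close> and \<open>k = i + 1\<close>.\<close>

lemma clustered_descents_imp_form:
  fixes w :: "nat \<Rightarrow> nat"
  assumes n: "2 \<le> n" and w: "w permutes {1..n}"
    and irred: "\<forall>r\<in>{1..<n}. w ` {1..r} \<noteq> {1..r}"
    and right: "clustered_descents n w" and left: "clustered_descents n (inv w)"
  shows "\<exists>k\<in>{1..n - 1}. (\<forall>q\<in>{1..n}. w q = (if q \<le> n - k then k + q else q - (n - k))) \<or>
    (\<forall>q\<in>{1..n}. w q = (if q \<le> n - k then k + q else if q = Suc (n - k) then k else q - Suc (n - k)))"
proof -
  define v where "v = inv w"
  have v: "v permutes {1..n}" using permutes_inv[OF w] by (simp add: v_def)
  have vw [simp]: "v (w q) = q" "w (v q) = q" for q using permutes_inverses[OF w]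
    by (simp_all add: v_def)
  have w_eq: "w a = b \<longleftrightarrow> a = v b" for a b by (metis vw)
  have wr: "w q \<in> {1..n}" if "q \<in> {1..n}" for q using permutes_in_image[OF w] that by blast
  have vr: "v q \<in> {1..n}" if "q \<in> {1..n}" for q using permutes_in_image[OF v] that by blast
  have w1: "w 1 \<noteq> 1" using bspec[OF irred, of 1] n by auto
  have wn: "w n \<noteq> n"
  proof
    assume "w n = n"
    then have "w ` ({1..n} - {n}) = {1..n} - {n}"
      using image_set_diff[OF permutes_inj[OF w], of "{1..n}" "{n}"] permutes_image[OF w] by simp
    moreover have "{1..n} - {n} = {1..n - 1}" using n by auto
    ultimately show False using bspec[OF irred, of "n - 1"] n by auto
  qed
  have v1: "v 1 \<noteq> 1" and vn: "v n \<noteq> n" using w1 wn by (metis vw)+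
  have "w \<noteq> id" "v \<noteq> id" using w1 v1 by auto
  obtain p where p: "p \<in> {1..<n}" "w (Suc p) < w p"
    "\<And>k. 1 \<le> k \<Longrightarrow> k < p \<Longrightarrow> w k < w (Suc k)"
    "\<And>k. Suc (Suc p) \<le> k \<Longrightarrow> k < n \<Longrightarrow> w k < w (Suc k)"
    using clustered_descents_runs[OF w \<open>w \<noteq> id\<close> right] by blast
  obtain i where i: "i \<in> {1..<n}" "v (Suc i) < v i"
    "\<And>k. 1 \<le> k \<Longrightarrow> k < i \<Longrightarrow> v k < v (Suc k)"
    "\<And>k. Suc (Suc i) \<le> k \<Longrightarrow> k < n \<Longrightarrow> v k < v (Suc k)"
    using clustered_descents_runs[OF v \<open>v \<noteq> id\<close>] left by (metis v_def)
  \<comment> \<open>The value 1, unless it comes first, is entered by a descent, hence sits directly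
    after one.\<close>
  have one: "y = Suc q \<or> y = Suc (Suc q)"
    if f: "f permutes {1..n}" and q: "q \<in> {1..<n}" "f (Suc q) < f q"
      "\<And>k. 1 \<le> k \<Longrightarrow> k < q \<Longrightarrow> f k < f (Suc k)" "\<And>k. Suc (Suc q) \<le> k \<Longrightarrow> k < n \<Longrightarrow> f k < f (Suc k)"
      and y: "y \<in> {1..n}" "f y = 1" "y \<noteq> 1" for f q y
  proof (rule ccontr)
    assume "\<not> ?thesis"
    then have "f (y - 1) < f (Suc (y - 1))"
      using q(3)[of "y - 1"] q(4)[of "y - 1"] y by (cases "y - 1 < q") auto
    moreover have "f (y - 1) \<in> {1..n}" using permutes_in_image[OF f, of "y - 1"] y by auto
    ultimately show False using y by auto
  qed
  \<comment> \<open>The value \<open>n\<close>, unless it comes last, is left by a descent. The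
    position \<open>Suc q\<close> is excluded because its value is smaller than
    \<open>f q\<close>.\<close>
  have last: "f q = n"
    if f: "f permutes {1..n}" and q: "q \<in> {1..<n}" "f (Suc q) < f q"
      "\<And>k. 1 \<le> k \<Longrightarrow> k < q \<Longrightarrow> f k < f (Suc k)" "\<And>k. Suc (Suc q) \<le> k \<Longrightarrow> k < n \<Longrightarrow> f k < f (Suc k)"
      and y: "y \<in> {1..n}" "f y = n" "y \<noteq> n" for f q y
  proof (rule ccontr)
    assume "f q \<noteq> n"
    then have "y \<noteq> q" using y by auto
    moreover have "f q \<in> {1..n}" using permutes_in_image[OF f, of q] q(1) by auto
    then have "y \<noteq> Suc q" using q(2) y by auto
    ultimately have "f y < f (Suc y)" using q(3)[of y] q(4)[of y] y by (cases "y < q") auto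
    moreover have "f (Suc y) \<in> {1..n}" using permutes_in_image[OF f, of "Suc y"] y by auto
    ultimately show False using y by auto
  qed
  have "1 \<in> {1..n}" "n \<in> {1..n}" using n by auto
  have vone: "v 1 = Suc p \<or> v 1 = Suc (Suc p)"
    using one[OF w p, of "v 1"] vr[OF \<open>1 \<in> _\<close>] v1 by simp
  have wone: "w 1 = Suc i \<or> w 1 = Suc (Suc i)"
    using one[OF v i, of "w 1"] wr[OF \<open>1 \<in> _\<close>] w1 by simp
  have wp: "w p = n" using last[OF w p, of "v n"] vr[OF \<open>n \<in> _\<close>] vn by simp
  have vi: "v i = n" using last[OF v i, of "w n"] wr[OF \<open>n \<in> _\<close>] wn by simp
  have vn': "v n = p" and wn': "w n = i" using wp vi by (metis vw)+
  have w_first: "w x + (y - x) \<le> w y" if "1 \<le> x" "x \<le> y" "y \<le> p" for x y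
    using strict_mono_stepI[of 1 p w x y] p(3) that by auto
  have w_last: "w x + (y - x) \<le> w y" if "Suc (Suc p) \<le> x" "x \<le> y" "y \<le> n" for x y
    using strict_mono_stepI[of "Suc (Suc p)" n w x y] p(4) that by auto
  have v_first: "v x + (y - x) \<le> v y" if "1 \<le> x" "x \<le> y" "y \<le> i" for x y
    using strict_mono_stepI[of 1 i v x y] i(3) that by auto
  have v_last: "v x + (y - x) \<le> v y" if "Suc (Suc i) \<le> x" "x \<le> y" "y \<le> n" for x y
    using strict_mono_stepI[of "Suc (Suc i)" n v x y] i(4) that by auto
  show ?thesis
  proof (cases "w 1 = Suc i")
    case True
    then have vSi: "v (Suc i) = 1" by (metis vw(1))
    \<comment> \<open>Here \<open>v (Suc i) = 1\<close> is the minimum, so the second run of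
      \<open>v\<close> extends one place to the left.\<close>
    have v_last': "v x + (y - x) \<le> v y" if "Suc i \<le> x" "x \<le> y" "y \<le> n" for x y
    proof (rule strict_mono_stepI[of "Suc i" n v, OF _ that])
      fix k assume k: "Suc i \<le> k" "k < n"
      show "v k < v (Suc k)"
      proof (cases "k = Suc i")
        case True
        have "v (Suc k) \<noteq> v (Suc i)" using True by (metis vw(2) n_not_Suc_n)
        then show ?thesis using vSi True vr[of "Suc k"] k by auto
      qed (use i(4) k in auto)
    qed
    \<comment> \<open>Otherwise position \<open>Suc p\<close> would belong to neither run of
      \<open>v\<close>: the first run starts with \<open>p + 2\<close>, the second ends with
      \<open>v n = p\<close>.\<close>
    have "v 1 \<noteq> Suc (Suc p)"
    proof
      assume "v 1 = Suc (Suc p)"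
      then have Sp: "Suc (Suc p) \<le> n" using vr[OF \<open>1 \<in> _\<close>] by auto
      show False
      proof (cases "w (Suc p) \<le> i")
        case True
        then show False using v_first[of 1 "w (Suc p)"] wr[of "Suc p"] Sp \<open>v 1 = _\<close>
          by auto
      next
        case False
        then show False using v_last'[of "w (Suc p)" n] wr[of "Suc p"] Sp vn' by auto
      qed
    qed
    then have v1p: "v 1 = Suc p" using vone by blast
    then have wSp: "w (Suc p) = 1" by (metis vw(2))
    have w_last': "w x + (y - x) \<le> w y" if "Suc p \<le> x" "x \<le> y" "y \<le> n" for x y
    proof (rule strict_mono_stepI[of "Suc p" n w, OF _ that])
      fix k assume k: "Suc p \<le> k" "k < n"
      show "w k < w (Suc k)"
      proof (cases "k = Suc p")
        case True
        have "w (Suc k) \<noteq> w (Suc p)" using True by (metis vw(1) n_not_Suc_n)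
        then show ?thesis using wSp True wr[of "Suc k"] k by auto
      qed (use p(4) k in auto)
    qed
    \<comment> \<open>The lower bound comes from the increasing run of \<open>w\<close>, the upper
      bound from that of its inverse.\<close>
    have A: "w q = i + q" if q: "q \<in> {1..p}" for q
    proof -
      have "i + q \<le> w q" using w_first[of 1 q] q True by auto
      moreover have "q \<in> {1..n}" using q p(1) by auto
      ultimately show ?thesis using v_last'[of "Suc i" "w q"] vSi q wr[of q] by auto
    qed
    have np: "n = i + p" using A[of p] wp p(1) by auto
    have B: "w q = q - p" if q: "q \<in> {Suc p..n}" for q
    proof -
      have ge: "q - p \<le> w q" using w_last'[of "Suc p" q] q wSp by auto
      have "w q \<in> {1..n}" using wr[of q] q by auto
      have "w q \<le> i"
      proof (rule ccontr)
        assume "\<not> w q \<le> i"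
        moreover from this have "w q - i \<in> {1..p}" using np \<open>w q \<in> {1..n}\<close>
          by simp linarith
        ultimately have "w (w q - i) = w q" using A[of "w q - i"] by simp
        then have "w q - i = q" by (metis vw(1))
        then show False using np \<open>w q \<in> {1..n}\<close> q by auto
      qed
      then show ?thesis using v_first[of 1 "w q"] v1p \<open>w q \<in> {1..n}\<close> ge by auto
    qed
    have "\<forall>q\<in>{1..n}. w q = (if q \<le> n - i then i + q else q - (n - i))"
      using A B np by auto
    moreover have "i \<in> {1..n - 1}" using i(1) by auto
    ultimately show ?thesis by blast
  next
    case False
    then have w1i: "w 1 = Suc (Suc i)" using wone by blast
    then have vSSi: "v (Suc (Suc i)) = 1" by (metis vw(1))
    have in_n: "Suc (Suc i) \<le> n" using wr[OF \<open>1 \<in> _\<close>] w1i by auto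
    \<comment> \<open>The value \<open>i + 1\<close> cannot occur up to position \<open>p\<close>,
      where values are at least \<open>w 1 = i + 2\<close>, nor in the second run, which increases
      to \<open>w n = i\<close>. Only the gap position \<open>Suc p\<close> between the runs is left
      for it.\<close>
    define m where "m = v (Suc i)"
    have wm: "w m = Suc i" by (simp add: m_def)
    have m: "m \<in> {1..n}" using vr[of "Suc i"] in_n by (auto simp: m_def)
    have mp: "\<not> m \<le> p" using w_first[of 1 m] wm w1i m by auto
    have "v 1 \<noteq> Suc p"
    proof
      assume "v 1 = Suc p"
      then have wSp: "w (Suc p) = 1" by (metis vw(2))
      have "w m + (n - m) \<le> w n"
      proof (cases "m = Suc p")
        case True
        then show ?thesis using wm wSp i(1) by auto
      next
        case False
        then show ?thesis using w_last[of m n] m mp by auto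
      qed
      then show False using wm wn' by auto
    qed
    then have v1p: "v 1 = Suc (Suc p)" using vone by blast
    then have wSSp: "w (Suc (Suc p)) = 1" by (metis vw(2))
    have "m = Suc p" using w_last[of m n] m mp wm wn' by (cases "m = Suc p") auto
    then have wSp: "w (Suc p) = Suc i" using wm by simp
    have A: "w q = Suc i + q" if q: "q \<in> {1..p}" for q
    proof -
      have "Suc i + q \<le> w q" using w_first[of 1 q] q w1i by auto
      moreover have "q \<in> {1..n}" using q p(1) by auto
      ultimately show ?thesis using v_last[of "Suc (Suc i)" "w q"] vSSi q wr[of q] by auto
    qed
    have np: "n = Suc i + p" using A[of p] wp p(1) by auto
    have B: "w q = q - Suc p" if q: "q \<in> {Suc (Suc p)..n}" for q
    proof -
      have ge: "q - Suc p \<le> w q" using w_last[of "Suc (Suc p)" q] q wSSp by auto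
      have "w q \<in> {1..n}" using wr[of q] q by auto
      have "w q \<noteq> Suc i" using wSp q w_eq[of q "Suc i"] w_eq[of "Suc p" "Suc i"] by auto
      have "w q \<le> i"
      proof (rule ccontr)
        assume "\<not> w q \<le> i"
        moreover from this have "w q - Suc i \<in> {1..p}"
          using np \<open>w q \<in> {1..n}\<close> \<open>w q \<noteq> Suc i\<close>
          by simp linarith
        ultimately have "w (w q - Suc i) = w q" using A[of "w q - Suc i"] by simp
        then have "w q - Suc i = q" by (metis vw(1))
        then show False using np \<open>w q \<in> {1..n}\<close> q by auto
      qed
      then show ?thesis using v_first[of 1 "w q"] v1p \<open>w q \<in> {1..n}\<close> ge by auto
    qed
    have "\<forall>q\<in>{1..n}. w q = (if q \<le> n - Suc i then Suc i + q else if q = Suc (n - Suc i) then Suc i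
        else q - Suc (n - Suc i))"
      using A B np wSp by auto
    moreover have "Suc i \<in> {1..n - 1}" using in_n by auto
    ultimately show ?thesis by blast
  qed
qed

lemma form_imp_clustered_descents:
  fixes w :: "nat \<Rightarrow> nat"
  assumes w: "w permutes {1..n}" and k: "k \<in> {1..n - 1}"
    and form: "(\<forall>q\<in>{1..n}. w q = (if q \<le> n - k then k + q else q - (n - k))) \<or>
      (\<forall>q\<in>{1..n}. w q = (if q \<le> n - k then k + q else if q = Suc (n - k) then k else q - Suc (n - k)))"
  shows "clustered_descents n w" "clustered_descents n (inv w)"
proof -
  have "q = n - k \<or> q = Suc (n - k)" if "q \<in> {1..<n}" "w (Suc q) < w q" for q
    using form that k by (elim disjE) (auto split: if_splits)
  note right = this
  show "clustered_descents n w" unfolding clustered_descents_def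
  proof (intro ballI impI)
    fix p q assume "p \<in> {1..<n}" "q \<in> {1..<n}" "w (Suc p) < w p" "w (Suc q) < w q"
    then show "q \<le> Suc p" using right[of p] right[of q] by auto
  qed
  have "Suc x = k \<or> x = k" if x: "x \<in> {1..<n}" "inv w (Suc x) < inv w x" for x
  proof -
    define a b where "a = inv w (Suc x)" and "b = inv w x"
    have "w a = Suc x" "w b = x" using permutes_inverses[OF w] by (auto simp: a_def b_def)
    moreover have "a \<in> {1..n}" "b \<in> {1..n}"
      using permutes_in_image[OF permutes_inv[OF w], of x] permutes_in_image[OF permutes_inv[OF w], of "Suc x"] x
      by (auto simp: a_def b_def)
    moreover have "a < b" using x by (simp add: a_def b_def)
    ultimately show ?thesis using form k by (elim disjE) (auto split: if_splits)
  qed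
  note left = this
  show "clustered_descents n (inv w)" unfolding clustered_descents_def
  proof (intro ballI impI)
    fix p q assume "p \<in> {1..<n}" "q \<in> {1..<n}" "inv w (Suc p) < inv w p" "inv w (Suc q) < inv w q"
    then show "q \<le> Suc p" using left[of p] left[of q] by auto
  qed
qed

lemma one_line_eq_iff:
  assumes "length xs = n"
  shows "one_line n w = xs \<longleftrightarrow> (\<forall>q\<in>{1..n}. w q = xs ! (q - 1))"
proof -
  have "one_line n w = xs \<longleftrightarrow> (\<forall>m<n. w (Suc m) = xs ! m)"
    using assms by (auto simp: one_line_def list_eq_iff_nth_eq simp del: upt_Suc)
  also have "\<dots> \<longleftrightarrow> (\<forall>q\<in>{1..n}. w q = xs ! (q - 1))"
  proof
    assume all: "\<forall>m<n. w (Suc m) = xs ! m"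
    show "\<forall>q\<in>{1..n}. w q = xs ! (q - 1)"
    proof
      fix q assume "q \<in> {1..n}"
      then show "w q = xs ! (q - 1)" using spec[OF all, of "q - 1"] by auto
    qed
  next
    assume all: "\<forall>q\<in>{1..n}. w q = xs ! (q - 1)"
    show "\<forall>m<n. w (Suc m) = xs ! m" using bspec[OF all, of "Suc _"] by auto
  qed
  finally show ?thesis .
qed

lemma one_line_forms:
  assumes k: "k \<in> {1..n - 1}"
  shows "one_line n w = [k + 1..<n + 1] @ [1..<k + 1] \<longleftrightarrow>
      (\<forall>q\<in>{1..n}. w q = (if q \<le> n - k then k + q else q - (n - k)))"
    and "one_line n w = [k + 1..<n + 1] @ [k] @ [1..<k] \<longleftrightarrow>
      (\<forall>q\<in>{1..n}. w q = (if q \<le> n - k then k + q else if q = Suc (n - k) then k else q - Suc (n - k)))"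
proof -
  have len: "length ([k + 1..<n + 1] @ [1..<k + 1]) = n" "length ([k + 1..<n + 1] @ [k] @ [1..<k]) = n"
    using k by auto
  show "one_line n w = [k + 1..<n + 1] @ [1..<k + 1] \<longleftrightarrow>
      (\<forall>q\<in>{1..n}. w q = (if q \<le> n - k then k + q else q - (n - k)))"
    unfolding one_line_eq_iff[OF len(1)]
    by (intro ball_cong refl) (use k in \<open>auto simp: nth_append simp del: upt_Suc\<close>)
  show "one_line n w = [k + 1..<n + 1] @ [k] @ [1..<k] \<longleftrightarrow>
      (\<forall>q\<in>{1..n}. w q = (if q \<le> n - k then k + q else if q = Suc (n - k) then k else q - Suc (n - k)))"
    unfolding one_line_eq_iff[OF len(2)]
    by (intro ball_cong refl, use k in \<open>auto simp: nth_append nth_Cons' simp del: upt_Suc\<close>) arith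
qed

section \<open>Planar regions\<close>

text \<open>The graphs may touch between their ends, so \<open>S\<close> need not be a simple closed
  curve. A component that meets the open region between the graphs is trapped there, and every point
  outside the closed region escapes along a horizontal ray.\<close>

lemma inside_two_graphs:
  fixes f g :: "real \<Rightarrow> real"
  assumes cf: "continuous_on UNIV f" and cg: "continuous_on UNIV g"
    and le: "\<And>t. 0 \<le> t \<Longrightarrow> t \<le> h \<Longrightarrow> f t \<le> g t"
    and "f 0 = g 0" "f h = g h"
  defines "S \<equiv> {z. 0 \<le> - Im z \<and> - Im z \<le> h \<and> (Re z = f (- Im z) \<or> Re z = g (- Im z))}"
  shows "S \<union> inside S =
    {z. 0 \<le> - Im z \<and> - Im z \<le> h \<and> f (- Im z) \<le> Re z \<and> Re z \<le> g (- Im z)}" (is "_ = ?B")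
proof -
  have cf': "continuous_on UNIV (\<lambda>z. f (- Im z))" and cg': "continuous_on UNIV (\<lambda>z. g (- Im z))"
    by (intro continuous_on_compose2[OF cf] continuous_on_compose2[OF cg] continuous_intros; simp)+
  have clB: "closed ?B"
    by (intro closed_Collect_conj closed_Collect_le cf' cg' continuous_intros)
  have SB: "S \<subseteq> ?B" using le by (auto simp: S_def)
  define U where "U = {z. 0 < - Im z \<and> - Im z < h \<and> f (- Im z) < Re z \<and> Re z < g (- Im z)}"
  have opU: "open U" unfolding U_def
    by (intro open_Collect_conj open_Collect_less cf' cg' continuous_intros)
  have BU: "?B = S \<union> U"
  proof (intro equalityI subsetI)
    fix z assume "z \<in> ?B"
    then show "z \<in> S \<union> U" using assms(4,5)
      by (cases "- Im z = 0 \<or> - Im z = h") (auto simp: S_def U_def)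
  qed (use SB in \<open>auto simp: U_def\<close>)
  have bdU: "bounded U"
  proof -
    have "compact (f ` {0..h})" "compact (g ` {0..h})"
      by (auto intro!: compact_continuous_image continuous_on_subset[OF cf] continuous_on_subset[OF cg])
    then obtain a b where a: "\<And>t. t \<in> {0..h} \<Longrightarrow> \<bar>f t\<bar> \<le> a" and b: "\<And>t. t \<in> {0..h} \<Longrightarrow> \<bar>g t\<bar> \<le> b"
      by (force dest!: compact_imp_bounded simp: bounded_iff)
    show ?thesis
    proof (rule boundedI)
      fix z assume z: "z \<in> U"
      have "cmod z \<le> \<bar>Re z\<bar> + \<bar>Im z\<bar>" by (rule cmod_le)
      also have "\<dots> \<le> (a + b) + h"
        using z a[of "- Im z"] b[of "- Im z"] by (auto simp: U_def)
      finally show "cmod z \<le> a + b + h" .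
    qed
  qed
  have "z \<in> inside S" if z: "z \<in> U" for z
  proof -
    have zS: "z \<notin> S" using z by (auto simp: U_def S_def)
    define K where "K = connected_component_set (- S) z"
    have K: "connected K" "K \<subseteq> - S" "z \<in> K"
      using zS by (auto simp: K_def connected_component_subset)
    \<comment> \<open>Off \<open>S\<close>, the plane is the disjoint union of the open sets
      \<open>U\<close> and \<open>- ?B\<close>, and a connected set lies in one of them.\<close>
    have "K \<subseteq> U \<union> - ?B" using K(2) BU by auto
    then have "- ?B \<inter> K = {} \<or> U \<inter> K = {}"
      using connectedD[OF K(1) opU open_Compl[OF clB]] BU by blast
    then have "K \<subseteq> U" using \<open>K \<subseteq> U \<union> - ?B\<close> K(3) z by blast
    then show ?thesis using bdU zS bounded_subset by (auto simp: inside_def K_def)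
  qed
  moreover have "z \<notin> inside S" if z: "z \<notin> ?B" for z
  proof -
    have *: "z \<notin> inside S"
      if C: "C \<subseteq> - S" "connected C" "z \<in> C" "\<not> bounded C" for C
      using connected_component_maximal[OF C(3,2,1)] C(4) bounded_subset
      by (auto simp: inside_def)
    have ub: "\<not> bounded ((\<lambda>x. z + of_real x) ` {0..})" "\<not> bounded ((\<lambda>x. z - of_real x) ` {0..})"
    proof -
      have "\<exists>x\<ge>0. B < cmod (z + of_real x)" "\<exists>x\<ge>0. B < cmod (z - of_real x)"
        for B
      proof -
        have "B < cmod (z + of_real (cmod z + \<bar>B\<bar> + 1))"
          using norm_triangle_ineq2[of "complex_of_real (cmod z + \<bar>B\<bar> + 1)" "- z"]
          by (simp only: norm_of_real norm_minus_cancel add.commute diff_minus_eq_add)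
        moreover have "B < cmod (z - of_real (cmod z + \<bar>B\<bar> + 1))"
          using norm_triangle_ineq2[of "complex_of_real (cmod z + \<bar>B\<bar> + 1)" "z"]
          by (simp only: norm_of_real norm_minus_commute)
        ultimately show "\<exists>x\<ge>0. B < cmod (z + of_real x)" "\<exists>x\<ge>0. B < cmod (z - of_real x)"
          by (meson abs_ge_zero add_nonneg_nonneg norm_ge_zero zero_le_one)+
      qed
      then show "\<not> bounded ((\<lambda>x. z + of_real x) ` {0..})" "\<not> bounded ((\<lambda>x. z - of_real x) ` {0..})"
        unfolding bounded_iff by (auto simp: not_le)
    qed
    have con: "connected ((\<lambda>x. z + of_real x) ` {0..})" "connected ((\<lambda>x. z - of_real x) ` {0..})"
      by (intro connected_continuous_image continuous_intros; simp)+
    have mem: "z \<in> (\<lambda>x. z + of_real x) ` {0..}" "z \<in> (\<lambda>x. z - of_real x) ` {0..}"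
      by (auto intro!: image_eqI[of _ _ 0])
    \<comment> \<open>In the first case the point lies left of the graph of \<open>f\<close>, so the
      ray to the left avoids \<open>S\<close>. Otherwise it lies right of the graph of
      \<open>g\<close> or outside the range of depths, and the ray to the right does.\<close>
    show ?thesis
    proof (cases "0 \<le> - Im z \<and> - Im z \<le> h \<and> Re z \<le> g (- Im z)")
      case True
      then have "(\<lambda>x. z - of_real x) ` {0..} \<subseteq> - S"
        using z le[of "- Im z"] by (auto simp: S_def)
      from *[OF this con(2) mem(2) ub(2)] show ?thesis .
    next
      case False
      then have "(\<lambda>x. z + of_real x) ` {0..} \<subseteq> - S"
        using z le[of "- Im z"] by (auto simp: S_def)
      from *[OF this con(1) mem(1) ub(1)] show ?thesis .
    qed
  qed
  ultimately show ?thesis using BU by blast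
qed

lemma convex_hull_parallelogram:
  fixes a u v :: "'a :: real_vector"
  shows "convex hull {a, a + u, a + u + v, a + v} =
    {a + x *\<^sub>R u + y *\<^sub>R v | x y. 0 \<le> x \<and> x \<le> 1 \<and> 0 \<le> y \<and> y \<le> 1}" (is "?H = ?P")
proof
  show "?H \<subseteq> ?P"
  proof (rule hull_minimal)
    have "\<exists>x y. a = a + x *\<^sub>R u + y *\<^sub>R v \<and> 0 \<le> x \<and> x \<le> 1 \<and> 0 \<le> y \<and> y \<le> 1"
      "\<exists>x y. a + u = a + x *\<^sub>R u + y *\<^sub>R v \<and> 0 \<le> x \<and> x \<le> 1 \<and> 0 \<le> y \<and> y \<le> 1"
      "\<exists>x y. a + u + v = a + x *\<^sub>R u + y *\<^sub>R v \<and> 0 \<le> x \<and> x \<le> 1 \<and> 0 \<le> y \<and> y \<le> 1"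
      "\<exists>x y. a + v = a + x *\<^sub>R u + y *\<^sub>R v \<and> 0 \<le> x \<and> x \<le> 1 \<and> 0 \<le> y \<and> y \<le> 1"
      by (rule exI[of _ 0] exI[of _ 1], rule exI[of _ 0] exI[of _ 1], simp; fail)+
    then show "{a, a + u, a + u + v, a + v} \<subseteq> ?P" by blast
    show "convex ?P"
    proof (rule convexI)
      fix p q and c d :: real
      assume "p \<in> ?P" "q \<in> ?P" and cd: "0 \<le> c" "0 \<le> d" "c + d = 1"
      then obtain x y x' y' where
        p: "p = a + x *\<^sub>R u + y *\<^sub>R v" "x \<in> {0..1}" "y \<in> {0..1}" and
        q: "q = a + x' *\<^sub>R u + y' *\<^sub>R v" "x' \<in> {0..1}" "y' \<in> {0..1}" by auto
      have "c *\<^sub>R p + d *\<^sub>R q = (c + d) *\<^sub>R a + (c * x + d * x') *\<^sub>R u + (c * y + d * y') *\<^sub>R v"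
        unfolding p q by (simp add: algebra_simps)
      moreover have "c * x + d * x' \<in> {0..1}" "c * y + d * y' \<in> {0..1}"
        using convexD[OF convex_real_interval(5)[of 0 1] p(2) q(2) cd]
          convexD[OF convex_real_interval(5)[of 0 1] p(3) q(3) cd] by auto
      ultimately show "c *\<^sub>R p + d *\<^sub>R q \<in> ?P" using cd by auto
    qed
  qed
  show "?P \<subseteq> ?H"
  proof
    fix z assume "z \<in> ?P"
    then obtain x y where xy: "0 \<le> x" "x \<le> 1" "0 \<le> y" "y \<le> 1" and z: "z = a + x *\<^sub>R u + y *\<^sub>R v" by blast
    have *: "a \<in> ?H" "a + u \<in> ?H" "a + u + v \<in> ?H" "a + v \<in> ?H"
      by (simp_all add: hull_inc)
    have 1: "(1 - x) *\<^sub>R a + x *\<^sub>R (a + u) \<in> ?H"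
      by (rule convexD[OF convex_convex_hull]) (use xy * in auto)
    have 2: "(1 - x) *\<^sub>R (a + v) + x *\<^sub>R (a + u + v) \<in> ?H"
      by (rule convexD[OF convex_convex_hull]) (use xy * in auto)
    have "(1 - y) *\<^sub>R ((1 - x) *\<^sub>R a + x *\<^sub>R (a + u)) + y *\<^sub>R ((1 - x) *\<^sub>R (a + v) + x *\<^sub>R (a + u + v)) \<in> ?H"
      by (rule convexD[OF convex_convex_hull 1 2]) (use xy in auto)
    also have "(1 - y) *\<^sub>R ((1 - x) *\<^sub>R a + x *\<^sub>R (a + u)) + y *\<^sub>R ((1 - x) *\<^sub>R (a + v) + x *\<^sub>R (a + u + v)) = z"
      unfolding z by (simp add: algebra_simps)
    finally show "z \<in> ?H" .
  qed
qed

section \<open>Paths as graphs over the depth\<close>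

text \<open>For a side of drop \<open>c\<close> starting at depth \<open>b\<close>,
  \<open>clamp_to c (t - b)\<close> is the amount of its drop above depth \<open>t\<close>.
  Piecewise linear paths thus become sums of continuous terms without case distinctions.\<close>

definition clamp_to :: "real \<Rightarrow> real \<Rightarrow> real" where
  "clamp_to c x = max 0 (min x c)"

text \<open>
  Points are described by their depth \<open>- Im z\<close> below the top vertex and by \<open>Re z\<close>. Side \<open>i\<close> drops
  by \<open>drop_of i\<close> and has horizontal slope \<open>slope i\<close>, which increases with \<open>i\<close>.
\<close>

locale elnitsky =
  fixes n :: nat and \<theta> :: "nat \<Rightarrow> real"
  assumes half_convex: "half_convex_polygon n \<theta>"
begin

definition drop_of :: "nat \<Rightarrow> real" where
  "drop_of i = - sin (\<theta> i)"

definition slope :: "nat \<Rightarrow> real" where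
  "slope i = cos (\<theta> i) / drop_of i"

lemma drop_pos: "i \<in> {1..n} \<Longrightarrow> 0 < drop_of i"
  using half_convex sin_lt_zero by (auto simp: half_convex_polygon_def drop_of_def)

lemma side_vector_eq:
  "i \<in> {1..n} \<Longrightarrow> side_vector \<theta> i = Complex (slope i * drop_of i) (- drop_of i)"
  using drop_pos[of i] by (auto simp: side_vector_def slope_def complex_eq_iff) (simp add: drop_of_def)

lemma Re_side [simp]: "i \<in> {1..n} \<Longrightarrow> Re (side_vector \<theta> i) = slope i * drop_of i"
  and Im_side [simp]: "Im (side_vector \<theta> i) = - drop_of i"
  by (auto simp: side_vector_eq) (simp add: side_vector_def drop_of_def)

text \<open>The difference of the slopes is \<open>sin (\<theta> j - \<theta> i)\<close> divided by
  the product of the two drops, and the angles differ by less than a half turn.\<close>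

lemma slope_less: "slope i < slope j" if "i \<in> {1..n}" "j \<in> {1..n}" "i < j"
proof -
  have "\<theta> i < \<theta> j" "pi < \<theta> i" "\<theta> j < 2 * pi"
    using half_convex that by (auto simp: half_convex_polygon_def strict_mono_on_def)
  then have "0 < sin (\<theta> j - \<theta> i)" by (intro sin_gt_zero) auto
  then show ?thesis using drop_pos[OF that(1)] drop_pos[OF that(2)]
    by (simp add: slope_def field_simps sin_diff) (simp add: drop_of_def algebra_simps)
qed

lemma slope_eq_iff: "i \<in> {1..n} \<Longrightarrow> j \<in> {1..n} \<Longrightarrow> slope i = slope j \<longleftrightarrow> i = j"
  using slope_less[of i j] slope_less[of j i] by (cases i j rule: linorder_cases) auto

definition depth :: "(nat \<Rightarrow> nat) \<Rightarrow> nat \<Rightarrow> real" where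
  "depth u k = (\<Sum>i=1..k. drop_of (u i))"

lemma Im_path_vertex [simp]: "Im (path_vertex \<theta> u k) = - depth u k"
  by (simp add: path_vertex_def depth_def sum_negf)

lemma depth_0 [simp]: "depth u 0 = 0" by (simp add: depth_def)

lemma depth_Suc: "depth u (Suc k) = depth u k + drop_of (u (Suc k))"
  by (simp add: depth_def)

lemma depth_pred: "1 \<le> k \<Longrightarrow> depth u k = depth u (k - 1) + drop_of (u k)"
  using depth_Suc[of u "k - 1"] by simp

definition total_depth :: real where
  "total_depth = (\<Sum>i=1..n. drop_of i)"

lemma depth_n: "u permutes {1..n} \<Longrightarrow> depth u n = total_depth"
  using sum.permute[of u "{1..n}" drop_of] by (simp add: depth_def total_depth_def o_def)

text \<open>The path of \<open>u\<close> is the graph of \<open>path_at u\<close>, as a function of the depth.\<close>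

definition path_at :: "(nat \<Rightarrow> nat) \<Rightarrow> real \<Rightarrow> real" where
  "path_at u t = (\<Sum>k=1..n. slope (u k) * clamp_to (drop_of (u k)) (t - depth u (k - 1)))"

lemma continuous_clamp_to: "continuous_on A f \<Longrightarrow> continuous_on A (\<lambda>t. clamp_to c (f t))"
  unfolding clamp_to_def by (intro continuous_intros)

lemma continuous_path_at: "continuous_on A (path_at u)"
  unfolding path_at_def[abs_def] by (intro continuous_intros continuous_clamp_to)

context
  fixes u assumes u: "u permutes {1..n}"
begin

lemma perm_in: "u k \<in> {1..n} \<longleftrightarrow> k \<in> {1..n}"
  using permutes_in_image[OF u] .

lemma drop_perm_pos: "k \<in> {1..n} \<Longrightarrow> 0 < drop_of (u k)"
  using drop_pos perm_in by blast

lemma depth_mono: "j \<le> k \<Longrightarrow> k \<le> n \<Longrightarrow> depth u j \<le> depth u k"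
proof (induction k rule: dec_induct)
  case (step m)
  then show ?case using drop_perm_pos[of "Suc m"] by (simp add: depth_Suc)
qed auto

lemma depth_strict_mono: "j < k \<Longrightarrow> k \<le> n \<Longrightarrow> depth u j < depth u k"
  using depth_mono[of j "k - 1"] depth_pred[of k u] drop_perm_pos[of k] by fastforce

lemma depth_eq_iff: "j \<le> n \<Longrightarrow> k \<le> n \<Longrightarrow> depth u j = depth u k \<longleftrightarrow> j = k"
  using depth_strict_mono[of j k] depth_strict_mono[of k j] by (cases j k rule: linorder_cases) auto

lemma depth_bounds: "k \<le> n \<Longrightarrow> 0 \<le> depth u k \<and> depth u k \<le> total_depth"
  using depth_mono[of 0 k] depth_mono[of k n] depth_n[OF u] by simp

lemma depth_interval:
  assumes "0 \<le> t" "t < total_depth"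
  obtains k where "k \<in> {1..n}" "depth u (k - 1) \<le> t" "t < depth u k"
proof -
  define k where "k = (LEAST k. t < depth u k)"
  have ex: "t < depth u n" using assms depth_n[OF u] by simp
  have k: "t < depth u k" unfolding k_def by (rule LeastI[of _ n]) (fact ex)
  have kn: "k \<le> n" unfolding k_def by (rule Least_le) (fact ex)
  have "k \<noteq> 0" using k assms by (cases "k = 0") auto
  then have "\<not> t < depth u (k - 1)" unfolding k_def by (intro not_less_Least) auto
  with that[of k] k kn \<open>k \<noteq> 0\<close> show ?thesis by auto
qed

lemma Re_path_vertex: "k \<le> n \<Longrightarrow> Re (path_vertex \<theta> u k) = (\<Sum>i=1..k. slope (u i) * drop_of (u i))"
  unfolding path_vertex_def Re_sum by (intro sum.cong refl Re_side) (use perm_in in auto)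

text \<open>At depth \<open>t\<close> the sides before \<open>k\<close> are complete and those after
  it have not begun. The coefficients are left free: slopes yield \<open>path_at\<close>, and the
  constant 1 shows that the parts used up to depth \<open>t\<close> add up to
  \<open>t\<close>.\<close>

lemma clamped_sum_on_side:
  fixes c :: "nat \<Rightarrow> real"
  assumes k: "k \<in> {1..n}" and t: "depth u (k - 1) \<le> t" "t \<le> depth u k"
  shows "(\<Sum>j=1..n. c j * clamp_to (drop_of (u j)) (t - depth u (j - 1))) =
    (\<Sum>j=1..k - 1. c j * drop_of (u j)) + c k * (t - depth u (k - 1))"
proof -
  let ?f = "\<lambda>j. c j * clamp_to (drop_of (u j)) (t - depth u (j - 1))"
  have split: "{1..n} = {1..k - 1} \<union> {k} \<union> {k + 1..n}" using k by auto
  have "sum ?f {1..n} = sum ?f {1..k - 1} + ?f k + sum ?f {k + 1..n}"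
    unfolding split
    by (subst sum.union_disjoint, simp, simp, force, subst sum.union_disjoint, simp, simp)
      (use k in auto)
  also have "sum ?f {1..k - 1} = (\<Sum>i=1..k - 1. c i * drop_of (u i))"
  proof (intro sum.cong refl)
    fix j assume j: "j \<in> {1..k - 1}"
    then have "depth u j \<le> t" "0 < drop_of (u j)"
      using depth_mono[of j "k - 1"] k t drop_perm_pos[of j] by force+
    then show "?f j = c j * drop_of (u j)"
      using j depth_pred[of j u] by (auto simp: clamp_to_def)
  qed
  also have "sum ?f {k + 1..n} = 0"
  proof (intro sum.neutral ballI)
    fix j assume j: "j \<in> {k + 1..n}"
    then have "t \<le> depth u (j - 1)" "0 < drop_of (u j)"
      using depth_mono[of k "j - 1"] k t drop_perm_pos[of j] by force+
    then show "?f j = 0" by (auto simp: clamp_to_def)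
  qed
  also have "?f k = c k * (t - depth u (k - 1))"
    using t k depth_pred[of k u] by (auto simp: clamp_to_def)
  finally show ?thesis by simp
qed

lemma path_at_on_side:
  assumes k: "k \<in> {1..n}" and t: "depth u (k - 1) \<le> t" "t \<le> depth u k"
  shows "path_at u t = Re (path_vertex \<theta> u (k - 1)) + slope (u k) * (t - depth u (k - 1))"
proof -
  have "k - 1 \<le> n" using k by auto
  then show ?thesis
    using clamped_sum_on_side[OF assms, of "\<lambda>j. slope (u j)"] Re_path_vertex[of "k - 1"]
    by (simp add: path_at_def)
qed

lemma path_at_vertex:
  assumes "k \<le> n" "1 \<le> n" shows "path_at u (depth u k) = Re (path_vertex \<theta> u k)"
proof (cases "k = n")
  case True
  then show ?thesis using assms path_at_on_side[of n "depth u n"] depth_mono[of "n - 1" n] depth_pred[of n u]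
      Re_path_vertex[of "n - 1"] Re_path_vertex[of n]
    by (cases n) (auto simp: depth_Suc)
next
  case False
  then show ?thesis using assms path_at_on_side[of "k + 1" "depth u k"] depth_mono[of k "k + 1"]
    by auto
qed

lemma path_side_eq:
  assumes k: "k \<in> {1..n}"
  shows "path_side \<theta> u k = {z. depth u (k - 1) \<le> - Im z \<and> - Im z \<le> depth u k \<and> Re z = path_at u (- Im z)}"
    (is "_ = ?R")
proof -
  let ?p = "path_vertex \<theta> u (k - 1)" and ?s = "drop_of (u k)"
  have s: "0 < ?s" using k drop_perm_pos by blast
  have pk: "path_vertex \<theta> u k = ?p + side_vector \<theta> (u k)"
    using k by (cases k) (auto simp: path_vertex_def)
  have uk: "u k \<in> {1..n}" using k perm_in by blast
  have d: "depth u k = depth u (k - 1) + ?s" using k depth_pred by auto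
  show ?thesis
  proof (intro equalityI subsetI)
    fix z assume "z \<in> path_side \<theta> u k"
    then obtain c where c: "0 \<le> c" "c \<le> 1" "z = ?p + of_real c * side_vector \<theta> (u k)"
      unfolding path_side_def pk closed_segment_def
        by (auto simp: scaleR_conv_of_real algebra_simps)
    have im: "- Im z = depth u (k - 1) + c * ?s" using c(3) by simp
    have "c * ?s \<le> ?s" "0 \<le> c * ?s" using c s by auto
    then show "z \<in> ?R" using im d path_at_on_side[OF k, of "- Im z"] c(3) Re_side[OF uk] by auto
  next
    fix z assume z: "z \<in> ?R"
    define c where "c = (- Im z - depth u (k - 1)) / ?s"
    have "0 \<le> c" "c \<le> 1" "c * ?s = - Im z - depth u (k - 1)" using z s d
      by (auto simp: c_def field_simps)
    moreover have "Re z = Re ?p + slope (u k) * (c * ?s)"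
      using z path_at_on_side[OF k, of "- Im z"] unfolding \<open>c * ?s = _\<close> by auto
    then have "z = ?p + of_real c * side_vector \<theta> (u k)"
      using Re_side[OF uk] \<open>c * ?s = _\<close> by (auto simp: complex_eq_iff)
    ultimately show "z \<in> path_side \<theta> u k"
      unfolding path_side_def pk closed_segment_def
      by (auto simp: scaleR_conv_of_real algebra_simps intro!: exI[of _ c])
  qed
qed

lemma path_eq:
  assumes "1 \<le> n"
  shows "(\<Union>k\<in>{1..n}. path_side \<theta> u k) =
    {z. 0 \<le> - Im z \<and> - Im z \<le> total_depth \<and> Re z = path_at u (- Im z)}" (is "_ = ?R")
proof (intro equalityI subsetI)
  fix z assume "z \<in> (\<Union>k\<in>{1..n}. path_side \<theta> u k)"
  then obtain k where "k \<in> {1..n}" "z \<in> path_side \<theta> u k" by blast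
  moreover have "k - 1 \<le> n" using \<open>k \<in> {1..n}\<close> by auto
  ultimately show "z \<in> ?R" using path_side_eq[of k] depth_bounds[of "k - 1"] depth_bounds[of k]
    by auto
next
  fix z assume z: "z \<in> ?R"
  show "z \<in> (\<Union>k\<in>{1..n}. path_side \<theta> u k)"
  proof (cases "- Im z = total_depth")
    case True
    then have "z \<in> path_side \<theta> u n"
      using z assms path_side_eq[of n] depth_mono[of "n - 1" n] depth_n[OF u] by auto
    then show ?thesis using assms by force
  next
    case False
    then obtain k where "k \<in> {1..n}" "depth u (k - 1) \<le> - Im z" "- Im z < depth u k"
      using z depth_interval[of "- Im z"] by force
    then show ?thesis using z path_side_eq[of k] by force
  qed
qed

lemma path_at_slope:
  assumes p: "p \<in> {1..n}" and lo: "depth u (p - 1) \<le> lo" "lo < hi" "hi \<le> depth u p"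
    and eq: "\<And>t. lo < t \<Longrightarrow> t < hi \<Longrightarrow> path_at u t = c + m * t"
  shows "m = slope (u p)"
proof -
  obtain x where x: "lo < x" "x < hi" using lo(2) dense by blast
  obtain y where y: "x < y" "y < hi" using x(2) dense by blast
  have "c + m * x = Re (path_vertex \<theta> u (p - 1)) + slope (u p) * (x - depth u (p - 1))"
    "c + m * y = Re (path_vertex \<theta> u (p - 1)) + slope (u p) * (y - depth u (p - 1))"
    using eq[of x] eq[of y] path_at_on_side[OF p, of x] path_at_on_side[OF p, of y] x y lo by auto
  then have "(m - slope (u p)) * (y - x) = 0" by (auto simp: algebra_simps)
  then show ?thesis using y by auto
qed

text \<open>As the directions are distinct, a unit segment on the path is one of its sides.\<close>

lemma path_at_linear_imp_side:
  assumes i: "i \<in> {1..n}" and b: "0 \<le> b" "b + drop_of i \<le> total_depth"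
    and eq: "\<And>t. b < t \<Longrightarrow> t < b + drop_of i \<Longrightarrow> path_at u t = c + slope i * t"
  obtains p where "p \<in> {1..n}" "u p = i" "depth u (p - 1) = b"
proof -
  have si: "0 < drop_of i" using i drop_pos by blast
  obtain p where p: "p \<in> {1..n}" "depth u (p - 1) \<le> b" "b < depth u p"
    using depth_interval[of b] b si by force
  have "slope i = slope (u p)"
    by (rule path_at_slope[OF p(1,2), of "min (depth u p) (b + drop_of i)" c]) (use p si eq in auto)
  then have up: "u p = i" using i p(1) perm_in slope_eq_iff by blast
  have dp: "depth u p = depth u (p - 1) + drop_of i" using depth_pred[of p u] p(1) up by auto
  \<comment> \<open>A segment starting in the interior of side \<open>p\<close> would spill over
    into side \<open>p + 1\<close>, which exists because the segment ends within the total depth.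
    Equal slopes would then give two sides with the same label.\<close>
  have "depth u (p - 1) = b"
  proof (rule ccontr)
    assume "depth u (p - 1) \<noteq> b"
    then have lt: "depth u p < b + drop_of i" using dp p(2) by simp
    then have pn: "p < n" using b depth_n[OF u] p(1) by (cases "p = n") auto
    have "slope i = slope (u (p + 1))"
      by (rule path_at_slope[of "p + 1" "depth u p" "min (depth u (p + 1)) (b + drop_of i)" c])
        (use pn p lt eq depth_strict_mono[of p "p + 1"] in auto)
    then have "u (p + 1) = i" using i pn perm_in[of "p + 1"] slope_eq_iff by auto
    then show False using up permutes_inj[OF u] by (metis injD n_not_Suc_n Suc_eq_plus1)
  qed
  with that p(1) up show ?thesis by blast
qed

end

lemma path_at_0 [simp]: "1 \<le> n \<Longrightarrow> u permutes {1..n} \<Longrightarrow> path_at u 0 = 0"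
  using path_at_vertex[of u 0] by (simp add: path_vertex_def)

lemma path_at_total_depth:
  assumes "1 \<le> n" "u permutes {1..n}"
  shows "path_at u total_depth = (\<Sum>i=1..n. slope i * drop_of i)"
  using path_at_vertex[OF assms(2), of n] depth_n[OF assms(2)] assms Re_path_vertex[OF assms(2), of n]
    sum.permute[OF assms(2), of "\<lambda>i. slope i * drop_of i"]
  by (simp add: o_def)

text \<open>
  The depth \<open>t\<close> is distributed among the labels: \<open>used w i t\<close> is the part of side \<open>i\<close> above depth
  \<open>t\<close> on the path of \<open>w\<close>. The identity uses the smallest slopes first and thus stays leftmost.
\<close>

definition used :: "(nat \<Rightarrow> nat) \<Rightarrow> nat \<Rightarrow> real \<Rightarrow> real" where
  "used w i t = clamp_to (drop_of i) (t - depth w (inv w i - 1))"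

lemma path_at_eq_sum_used:
  assumes "w permutes {1..n}"
  shows "path_at w t = (\<Sum>i=1..n. slope i * used w i t)"
  using sum.permute[OF assms, of "\<lambda>i. slope i * used w i t"]
  by (simp add: o_def used_def path_at_def permutes_inverses[OF assms])

lemma sum_used:
  assumes w: "w permutes {1..n}" and t: "0 \<le> t" "t < total_depth"
  shows "(\<Sum>i=1..n. used w i t) = t"
proof -
  obtain k where k: "k \<in> {1..n}" "depth w (k - 1) \<le> t" "t < depth w k"
    using depth_interval[OF w t] by blast
  have "(\<Sum>i=1..n. used w i t) = (\<Sum>j=1..n. 1 * clamp_to (drop_of (w j)) (t - depth w (j - 1)))"
    using sum.permute[OF w, of "\<lambda>i. used w i t"]
    by (simp add: o_def used_def permutes_inverses[OF w])
  also have "\<dots> = t"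
    using clamped_sum_on_side[OF w k(1,2), of "\<lambda>_. 1"] k by (simp add: depth_def)
  finally show ?thesis .
qed

lemma used_side:
  assumes w: "w permutes {1..n}" and k: "k \<in> {1..n}" "depth w (k - 1) \<le> t" "t < depth w k"
    and q: "q \<in> {1..n}"
  shows "q < k \<Longrightarrow> used w (w q) t = drop_of (w q)"
    and "k < q \<Longrightarrow> used w (w q) t = 0"
    and "used w (w k) t = t - depth w (k - 1)"
proof -
  show "used w (w q) t = drop_of (w q)" if "q < k"
  proof -
    have "depth w q \<le> t" using depth_mono[OF w, of q "k - 1"] that k by force
    then show ?thesis using depth_pred[of q w] q drop_perm_pos[OF w q]
      by (auto simp: used_def permutes_inverses[OF w] clamp_to_def)
  qed
  show "used w (w q) t = 0" if "k < q"
  proof -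
    have "t \<le> depth w (q - 1)" using depth_mono[OF w, of k "q - 1"] that k q by force
    then show ?thesis using drop_perm_pos[OF w q]
      by (auto simp: used_def permutes_inverses[OF w] clamp_to_def)
  qed
  show "used w (w k) t = t - depth w (k - 1)"
    using k depth_pred[of k w] by (auto simp: used_def permutes_inverses[OF w] clamp_to_def)
qed

lemma used_bounds: "i \<in> {1..n} \<Longrightarrow> 0 \<le> used w i t \<and> used w i t \<le> drop_of i"
  using drop_pos[of i] by (auto simp: used_def clamp_to_def)

text \<open>An exchange argument relative to the slope of the current side \<open>r\<close> of the
  identity. Labels below \<open>r\<close> are used up by the identity and those above it are
  untouched, so each term \<open>(slope i - slope r) * (used w i t - used id i t)\<close> is
  nonnegative. Subtracting \<open>slope r\<close> changes nothing in the sum, since both paths have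
  used a total of \<open>t\<close>. Equality of the paths makes every term vanish.\<close>

lemma path_at_id_le:
  assumes w: "w permutes {1..n}" and t: "0 \<le> t" "t < total_depth"
    and r: "r \<in> {1..n}" "depth id (r - 1) \<le> t" "t < depth id r"
  shows "path_at id t \<le> path_at w t"
    and "path_at id t = path_at w t \<Longrightarrow> i \<in> {1..n} \<Longrightarrow> used w i t = used id i t"
proof -
  let ?d = "\<lambda>i. (slope i - slope r) * (used w i t - used id i t)"
  note us = used_side[OF permutes_id[of "{1..n}"] r]
  have nonneg: "0 \<le> ?d i \<and> (?d i = 0 \<longrightarrow> i = r \<or> used w i t = used id i t)" if i: "i \<in> {1..n}" for i
  proof (cases i r rule: linorder_cases)
    case less
    then show ?thesis using slope_less[OF i r(1) less] us(1)[OF i less] used_bounds[OF i, of w t]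
      by (auto simp: mult_nonpos_nonpos)
  next
    case greater
    then show ?thesis using slope_less[OF r(1) i greater] us(2)[OF i greater] used_bounds[OF i, of w t]
      by auto
  qed auto
  have total: "(\<Sum>i=1..n. used w i t - used id i t) = 0"
    using sum_used[OF w t] sum_used[OF permutes_id t] by (simp add: sum_subtractf)
  have diff: "path_at w t - path_at id t = (\<Sum>i=1..n. ?d i)"
  proof -
    have "(\<Sum>i=1..n. ?d i) = (\<Sum>i=1..n. slope i * (used w i t - used id i t)) -
        slope r * (\<Sum>i=1..n. used w i t - used id i t)"
      by (simp add: sum_distrib_left sum_subtractf[symmetric] algebra_simps)
    then show ?thesis using total
      by (simp add: path_at_eq_sum_used[OF w] path_at_eq_sum_used[OF permutes_id] sum_subtractf right_diff_distrib)
  qed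
  show "path_at id t \<le> path_at w t" using diff sum_nonneg[of "{1..n}" ?d] nonneg by force
  assume eq: "path_at id t = path_at w t" and i: "i \<in> {1..n}"
  then have "\<forall>i\<in>{1..n}. ?d i = 0"
    using diff sum_nonneg_eq_0_iff[of "{1..n}" ?d] nonneg by force
  then have other: "used w i t = used id i t" if "i \<in> {1..n}" "i \<noteq> r" for i
    using nonneg that by blast
  have "used w r t - used id r t = (\<Sum>i=1..n. used w i t - used id i t)"
    using other r(1) by (subst sum.remove[of _ r]) (auto intro!: sum.neutral)
  then show "used w i t = used id i t" using total other i by (cases "i = r") auto
qed

text \<open>If the paths met at an inner depth, both would have used the same amount of every label.
  The labels completed there form a prefix of both permutations, an initial segment stable under
  \<open>w\<close>.\<close>

lemma path_at_id_less:
  assumes n: "2 \<le> n" and w: "w permutes {1..n}"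
    and irred: "\<forall>r\<in>{1..<n}. w ` {1..r} \<noteq> {1..r}"
    and t: "0 < t" "t < total_depth"
  shows "path_at id t < path_at w t"
proof (rule ccontr)
  assume ge: "\<not> ?thesis"
  have t0: "0 \<le> t" using t by simp
  obtain r where r: "r \<in> {1..n}" "depth id (r - 1) \<le> t" "t < depth id r"
    using depth_interval[OF permutes_id t0 t(2)] by blast
  obtain k where k: "k \<in> {1..n}" "depth w (k - 1) \<le> t" "t < depth w k"
    using depth_interval[OF w t0 t(2)] by blast
  have eq: "used w i t = used id i t" if "i \<in> {1..n}" for i
    using path_at_id_le[OF w t0 t(2) r] ge that by (meson linorder_not_le order_antisym)
  note ui = used_side[OF permutes_id[of "{1..n}"] r, simplified] and uw = used_side[OF w k]
  have kfull: "used w (w k) t < drop_of (w k)" using uw(3)[OF k(1)] k(3) depth_pred[of k w] k(1)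
    by auto
  have rfull: "used id r t < drop_of r" using ui(3)[of r] r depth_pred[of r id] by auto
  have prefix: "w ` {1..k - 1} = {1..r - 1}"
  proof (intro equalityI subsetI)
    fix x assume "x \<in> w ` {1..k - 1}"
    then obtain q where q: "q \<in> {1..n}" "q < k" "x = w q" using k by auto
    then have x: "x \<in> {1..n}" using permutes_in_image[OF w] by blast
    have "used id x t = drop_of x" using uw(1)[OF q(1,2)] eq[OF x] q by simp
    then show "x \<in> {1..r - 1}" using ui(2)[of x] rfull drop_pos[OF x] x
      by (cases x r rule: linorder_cases) auto
  next
    fix x assume x: "x \<in> {1..r - 1}"
    then have xn: "x \<in> {1..n}" using r by auto
    then obtain q where q: "q \<in> {1..n}" "x = w q" using permutes_image[OF w] by (metis imageE)
    have "used w x t = drop_of x" using ui(1)[of x] x xn eq[OF xn] by auto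
    then have "q < k" using uw(2)[OF q(1)] kfull q drop_pos[OF xn]
      by (cases q k rule: linorder_cases) auto
    then show "x \<in> w ` {1..k - 1}" using q by auto
  qed
  then have "card {1..k - 1} = card {1..r - 1}"
    using card_image[OF permutes_inj_on[OF w]] by metis
  then have "k = r" using k r by auto
  show False
  proof (cases "r = 1")
    case False
    then show False using irred prefix \<open>k = r\<close> r by (auto dest!: bspec[of _ _ "r - 1"])
  next
    case True
    \<comment> \<open>The completed prefix is empty here. As \<open>t > 0\<close>, a part of label 1
      has been used, so \<open>w 1 = 1\<close>, and irreducibility fails at 1 instead.\<close>
    then have "used w 1 t = t" using eq[of 1] ui(3)[of 1] r by auto
    obtain q where q: "q \<in> {1..n}" "1 = w q" using permutes_image[OF w] n
      by (metis imageE atLeastAtMost_iff le_refl order_trans one_le_numeral)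
    then have "q = 1" using uw(2)[OF q(1)] t \<open>used w 1 t = t\<close> True \<open>k = r\<close>
      by (cases "q = 1") auto
    then show False using irred q n by (auto dest!: bspec[of _ _ 1])
  qed
qed

lemma path_at_id_le_total:
  assumes n: "1 \<le> n" and w: "w permutes {1..n}" and t: "0 \<le> t" "t \<le> total_depth"
  shows "path_at id t \<le> path_at w t"
proof (cases "t = total_depth")
  case True
  then show ?thesis using path_at_total_depth[OF n w] path_at_total_depth[OF n permutes_id] by simp
next
  case False
  then have "t < total_depth" using t by simp
  then obtain r where r: "r \<in> {1..n}" "depth id (r - 1) \<le> t" "t < depth id r"
    using depth_interval[OF permutes_id t(1)] by blast
  show ?thesis using path_at_id_le(1)[OF w t(1) \<open>t < total_depth\<close> r] .
qed

lemma elnitsky_polygon_eq: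
  assumes n: "1 \<le> n" and w: "w permutes {1..n}"
  shows "elnitsky_polygon n \<theta> w = {z. 0 \<le> - Im z \<and> - Im z \<le> total_depth \<and>
    path_at id (- Im z) \<le> Re z \<and> Re z \<le> path_at w (- Im z)}"
proof -
  have "elnitsky_boundary n \<theta> w = {z. 0 \<le> - Im z \<and> - Im z \<le> total_depth \<and>
      (Re z = path_at id (- Im z) \<or> Re z = path_at w (- Im z))}"
    unfolding elnitsky_boundary_def left_side_def right_side_def path_eq[OF w n] path_eq[OF permutes_id n]
    by auto
  then show ?thesis unfolding elnitsky_polygon_def
    using inside_two_graphs[OF continuous_path_at continuous_path_at, of total_depth id w]
      path_at_id_le_total[OF n w] path_at_total_depth[OF n w] path_at_total_depth[OF n permutes_id]
      path_at_0[OF n w] path_at_0[OF n permutes_id] by simp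
qed

section \<open>Tiles\<close>

text \<open>
  A triple \<open>(a, i, j)\<close> with \<open>i < j\<close> stands for the tile with top vertex \<open>a\<close> and edges labelled \<open>i\<close>
  and \<open>j\<close>. Downwards, its left contour traverses \<open>i\<close>, then \<open>j\<close>, its right contour \<open>j\<close>, then \<open>i\<close>.
\<close>

definition rhombus :: "complex \<times> nat \<times> nat \<Rightarrow> complex set" where
  "rhombus = (\<lambda>(a, i, j). convex hull {a, a + side_vector \<theta> i, a + side_vector \<theta> i + side_vector \<theta> j, a + side_vector \<theta> j})"

definition is_tile :: "complex \<times> nat \<times> nat \<Rightarrow> bool" where
  "is_tile = (\<lambda>(a, i, j). i \<in> {1..n} \<and> j \<in> {1..n} \<and> i < j)"

text \<open>The clamping extends the contour by constants above and below the tile, so the left and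
  right contours agree outside the range of depths of the tile.\<close>

definition contour :: "complex \<Rightarrow> nat \<Rightarrow> nat \<Rightarrow> real \<Rightarrow> real" where
  "contour a i j t = Re a + slope i * clamp_to (drop_of i) (t + Im a)
     + slope j * clamp_to (drop_of j) (t + Im a - drop_of i)"

definition top_depth :: "complex \<times> nat \<times> nat \<Rightarrow> real" where
  "top_depth = (\<lambda>(a, i, j). - Im a)"

definition bot_depth :: "complex \<times> nat \<times> nat \<Rightarrow> real" where
  "bot_depth = (\<lambda>(a, i, j). - Im a + drop_of i + drop_of j)"

definition left_at :: "complex \<times> nat \<times> nat \<Rightarrow> real \<Rightarrow> real" where
  "left_at = (\<lambda>(a, i, j). contour a i j)"

definition right_at :: "complex \<times> nat \<times> nat \<Rightarrow> real \<Rightarrow> real" where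
  "right_at = (\<lambda>(a, i, j). contour a j i)"

lemmas tile_defs = rhombus_def is_tile_def top_depth_def bot_depth_def left_at_def right_at_def

lemma continuous_contour: "continuous_on A (contour a i j)"
  unfolding contour_def[abs_def] by (intro continuous_intros continuous_clamp_to)

lemma continuous_left_at: "continuous_on A (left_at x)" and continuous_right_at: "continuous_on A (right_at x)"
  by (cases x; simp add: tile_defs continuous_contour)+

lemma top_less_bot: "is_tile x \<Longrightarrow> top_depth x < bot_depth x"
proof (cases x)
  case (fields a i j)
  assume "is_tile x"
  then show ?thesis using fields drop_pos[of i] drop_pos[of j] by (simp add: tile_defs)
qed

text \<open>Both contours are compared with one line of slope \<open>slope j\<close>. They differ
  only in the amount of drop spent along \<open>i\<close>: the left contour spends as much as
  possible (\<open>min\<close>), the right one as little as possible (\<open>max\<close>).\<close>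

lemma contour_min_max:
  assumes "i \<in> {1..n}" "j \<in> {1..n}" "- Im a \<le> t" "t \<le> - Im a + drop_of i + drop_of j"
  shows "contour a i j t = Re a + slope j * (t + Im a) - (slope j - slope i) * min (drop_of i) (t + Im a)"
    and "contour a j i t = Re a + slope j * (t + Im a) - (slope j - slope i) * max 0 (t + Im a - drop_of j)"
  using assms drop_pos[of i] drop_pos[of j]
  by (auto simp: contour_def clamp_to_def min_def max_def algebra_simps)

lemma left_less_right:
  assumes "is_tile x" "top_depth x < t" "t < bot_depth x"
  shows "left_at x t < right_at x t"
proof (cases x)
  case (fields a i j)
  have ij: "i \<in> {1..n}" "j \<in> {1..n}" "i < j" "- Im a < t" "t < - Im a + drop_of i + drop_of j"
    using assms fields by (auto simp: tile_defs)
  have "max 0 (t + Im a - drop_of j) < min (drop_of i) (t + Im a)"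
    using ij drop_pos[of i] drop_pos[of j] by auto
  then have "(slope j - slope i) * max 0 (t + Im a - drop_of j) < (slope j - slope i) * min (drop_of i) (t + Im a)"
    using slope_less[of i j] ij by (intro mult_strict_left_mono) auto
  then show ?thesis using contour_min_max[of i j a t] ij fields by (simp add: tile_defs)
qed

lemma left_right_top: "is_tile x \<Longrightarrow> left_at x (top_depth x) = right_at x (top_depth x)"
  and left_right_bot: "is_tile x \<Longrightarrow> left_at x (bot_depth x) = right_at x (bot_depth x)"
  by (cases x; use drop_pos in \<open>fastforce simp: tile_defs contour_def clamp_to_def max_def min_def\<close>)+

lemma rhombus_eq:
  assumes "is_tile x"
  shows "rhombus x = {z. top_depth x \<le> - Im z \<and> - Im z \<le> bot_depth x \<and>
    left_at x (- Im z) \<le> Re z \<and> Re z \<le> right_at x (- Im z)}"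
proof (cases x)
  case (fields a i j)
  have ij: "i \<in> {1..n}" "j \<in> {1..n}" "i < j" using assms fields by (auto simp: tile_defs)
  let ?p = "drop_of i" and ?q = "drop_of j" and ?d = "slope j - slope i"
  have pos: "0 < ?p" "0 < ?q" "0 < ?d" using ij drop_pos slope_less[of i j] by auto
  show ?thesis
  proof (intro equalityI subsetI)
    fix z assume "z \<in> rhombus x"
    then obtain c e where ce: "0 \<le> c" "c \<le> 1" "0 \<le> e" "e \<le> 1"
      and z: "z = a + c *\<^sub>R side_vector \<theta> i + e *\<^sub>R side_vector \<theta> j"
      using fields by (auto simp: rhombus_def convex_hull_parallelogram)
    have b: "0 \<le> c * ?p" "c * ?p \<le> ?p" "0 \<le> e * ?q" "e * ?q \<le> ?q"
      using ce pos by auto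
    have im: "- Im z = - Im a + c * ?p + e * ?q" using z by simp
    have re: "Re z = Re a + slope j * (- Im z + Im a) - ?d * (c * ?p)"
      using z Re_side[OF ij(1)] Re_side[OF ij(2)] by (simp add: algebra_simps)
    have "?d * max 0 (- Im z + Im a - ?q) \<le> ?d * (c * ?p)" "?d * (c * ?p) \<le> ?d * min ?p (- Im z + Im a)"
      using b im pos by (auto intro!: mult_left_mono)
    then show "z \<in> {z. top_depth x \<le> - Im z \<and> - Im z \<le> bot_depth x \<and>
        left_at x (- Im z) \<le> Re z \<and> Re z \<le> right_at x (- Im z)}"
      using contour_min_max[OF ij(1,2), of a "- Im z"] im re b fields by (auto simp: tile_defs)
  next
    fix z assume "z \<in> {z. top_depth x \<le> - Im z \<and> - Im z \<le> bot_depth x \<and>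
        left_at x (- Im z) \<le> Re z \<and> Re z \<le> right_at x (- Im z)}"
    then have im: "- Im a \<le> - Im z" "- Im z \<le> - Im a + ?p + ?q"
      and re: "contour a i j (- Im z) \<le> Re z" "Re z \<le> contour a j i (- Im z)"
      using fields by (auto simp: tile_defs)
    let ?t = "- Im z + Im a"
    \<comment> \<open>The drop spent along edge \<open>i\<close> on the way to \<open>z\<close>,
      solved from its horizontal position; the rest of the depth is spent along edge
      \<open>j\<close>.\<close>
    define r where "r = (Re a + slope j * ?t - Re z) / ?d"
    have dr: "?d * r = Re a + slope j * ?t - Re z" using pos by (simp add: r_def)
    have "?d * max 0 (?t - ?q) \<le> ?d * r" "?d * r \<le> ?d * min ?p ?t"
      using contour_min_max[OF ij(1,2) im] re dr by auto
    then have r: "max 0 (?t - ?q) \<le> r" "r \<le> min ?p ?t" using pos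
      by (auto simp: mult_le_cancel_left)
    have "z = a + (r / ?p) *\<^sub>R side_vector \<theta> i + ((?t - r) / ?q) *\<^sub>R side_vector \<theta> j"
      using pos dr Re_side[OF ij(1)] Re_side[OF ij(2)]
      by (auto simp: complex_eq_iff) (simp add: algebra_simps)
    moreover have "0 \<le> r / ?p" "r / ?p \<le> 1" "0 \<le> (?t - r) / ?q" "(?t - r) / ?q \<le> 1"
      using r pos by (auto simp: divide_simps)
    ultimately show "z \<in> rhombus x"
      using fields unfolding rhombus_def convex_hull_parallelogram by auto
  qed
qed

lemma interior_rhombus:
  assumes "is_tile x"
  shows "interior (rhombus x) = {z. top_depth x < - Im z \<and> - Im z < bot_depth x \<and>
    left_at x (- Im z) < Re z \<and> Re z < right_at x (- Im z)}" (is "_ = ?U")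
proof
  have im: "continuous_on UNIV (\<lambda>z. - Im z)" by (intro continuous_intros)
  have c: "continuous_on UNIV (\<lambda>z. left_at x (- Im z))" "continuous_on UNIV (\<lambda>z. right_at x (- Im z))"
    using continuous_on_compose2[OF continuous_left_at[of UNIV x] im]
      continuous_on_compose2[OF continuous_right_at[of UNIV x] im] by auto
  have "open ?U" by (intro open_Collect_conj open_Collect_less c continuous_intros)
  moreover have "?U \<subseteq> rhombus x" unfolding rhombus_eq[OF assms]
    by (intro Collect_mono) simp
  ultimately show "?U \<subseteq> interior (rhombus x)" by (rule interior_maximal[rotated])
  show "interior (rhombus x) \<subseteq> ?U"
  proof
    fix z assume "z \<in> interior (rhombus x)"
    then obtain e where e: "0 < e" "cball z e \<subseteq> rhombus x" using mem_interior_cball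
      by blast
    \<comment> \<open>Horizontal displacements make the contour inequalities strict, vertical ones
      the bounds on the depth.\<close>
    have in_ball: "z + of_real e \<in> rhombus x" "z - of_real e \<in> rhombus x"
      "z + \<i> * of_real e \<in> rhombus x" "z - \<i> * of_real e \<in> rhombus x"
      using e by (auto simp: dist_norm norm_mult intro!: subsetD[OF e(2)])
    show "z \<in> ?U" using in_ball e(1) unfolding rhombus_eq[OF assms] by simp
  qed
qed

definition slices_disjoint :: "complex \<times> nat \<times> nat \<Rightarrow> complex \<times> nat \<times> nat \<Rightarrow> bool" where
  "slices_disjoint x y \<longleftrightarrow> (\<forall>t. top_depth x < t \<longrightarrow> t < bot_depth x \<longrightarrow> top_depth y < t \<longrightarrow> t < bot_depth y \<longrightarrow>
     right_at x t \<le> left_at y t \<or> right_at y t \<le> left_at x t)"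

lemma interiors_disjoint_iff:
  assumes "is_tile x" "is_tile y"
  shows "interior (rhombus x) \<inter> interior (rhombus y) = {} \<longleftrightarrow> slices_disjoint x y"
proof
  assume disj: "interior (rhombus x) \<inter> interior (rhombus y) = {}"
  show "slices_disjoint x y" unfolding slices_disjoint_def
  proof (intro allI impI, rule ccontr)
    fix t assume t: "top_depth x < t" "t < bot_depth x" "top_depth y < t" "t < bot_depth y"
      and "\<not> (right_at x t \<le> left_at y t \<or> right_at y t \<le> left_at x t)"
    then have "max (left_at x t) (left_at y t) < min (right_at x t) (right_at y t)"
      using left_less_right assms by auto
    then obtain r where r: "max (left_at x t) (left_at y t) < r" "r < min (right_at x t) (right_at y t)"
      using dense by blast
    then have "Complex r (- t) \<in> interior (rhombus x) \<inter> interior (rhombus y)"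
      using t by (simp add: interior_rhombus assms)
    then show False using disj by blast
  qed
qed (force simp: interior_rhombus assms slices_disjoint_def)

text \<open>Moving the base point reverses an edge, so both edges may point downwards, and
  exchanging them sorts the labels.\<close>

lemma rhombic_tile_iff:
  "rhombic_tile n \<theta> R \<longleftrightarrow> (\<exists>x. is_tile x \<and> R = rhombus x)"
proof
  assume "rhombic_tile n \<theta> R"
  then obtain a u v where uv: "u \<in> edge_vectors n \<theta>" "v \<in> edge_vectors n \<theta>" "u \<noteq> v" "u \<noteq> - v"
    and R: "R = convex hull {a, a + u, a + u + v, a + v}" unfolding rhombic_tile_def by blast
  obtain i where i: "i \<in> {1..n}" "u = side_vector \<theta> i \<or> u = - side_vector \<theta> i"
    using uv by (auto simp: edge_vectors_def)
  obtain j where j: "j \<in> {1..n}" "v = side_vector \<theta> j \<or> v = - side_vector \<theta> j"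
    using uv by (auto simp: edge_vectors_def)
  let ?P = "\<lambda>a u v. convex hull {a, a + u, a + u + v, a + v :: complex}"
  have swap: "?P a u v = ?P a v u" for a u v
    by (rule arg_cong[where f = "\<lambda>X. convex hull X"]) (auto simp: algebra_simps)
  have minus: "?P a (- u) v = ?P (a - u) u v" for a u v
    by (rule arg_cong[where f = "\<lambda>X. convex hull X"]) (auto simp: algebra_simps)
  have "\<exists>b. R = ?P b (side_vector \<theta> i) v" using i(2) R minus by metis
  then obtain c where c: "R = ?P c (side_vector \<theta> i) (side_vector \<theta> j)"
    using j(2) swap minus by metis
  have "i \<noteq> j" using uv i j by auto
  then show "\<exists>x. is_tile x \<and> R = rhombus x"
    unfolding c using swap[of c "side_vector \<theta> i" "side_vector \<theta> j"] i(1) j(1)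
    by (intro exI[of _ "if i < j then (c, i, j) else (c, j, i)"]) (auto simp: is_tile_def rhombus_def)
next
  assume "\<exists>x. is_tile x \<and> R = rhombus x"
  then obtain a i j where ij: "i \<in> {1..n}" "j \<in> {1..n}" "i < j" and R: "R = rhombus (a, i, j)"
    by (auto simp: is_tile_def)
  have "side_vector \<theta> i \<noteq> side_vector \<theta> j"
  proof
    assume eq: "side_vector \<theta> i = side_vector \<theta> j"
    then have "drop_of i = drop_of j" using Im_side[of i] Im_side[of j] by simp
    moreover have "slope i * drop_of i = slope j * drop_of j"
      using eq Re_side[of i] Re_side[of j] ij by simp
    ultimately show False using slope_less[of i j] ij drop_pos[of j] by auto
  qed
  moreover have "side_vector \<theta> i \<noteq> - side_vector \<theta> j"
  proof
    assume "side_vector \<theta> i = - side_vector \<theta> j"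
    then have "Im (side_vector \<theta> i) = Im (- side_vector \<theta> j)" by simp
    then show False using drop_pos[of i] drop_pos[of j] ij by simp
  qed
  ultimately show "rhombic_tile n \<theta> R" unfolding rhombic_tile_def
    using ij R by (intro exI[of _ a] bexI[of _ "side_vector \<theta> i"] bexI[of _ "side_vector \<theta> j"])
      (auto simp: edge_vectors_def rhombus_def)
qed

section \<open>Families of tiles between two paths\<close>

text \<open>Tiles are compared with the paths only at depths strictly inside them, and coverage
  concerns only points strictly between the paths. Pieces of zero width, where the paths coincide,
  impose nothing, so the empty family fits \<open>u = w\<close>.\<close>

definition tiles_between :: "(complex \<times> nat \<times> nat) set \<Rightarrow> (nat \<Rightarrow> nat) \<Rightarrow> (nat \<Rightarrow> nat) \<Rightarrow> bool" where
  "tiles_between T u w \<longleftrightarrow> finite T \<and>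
     (\<forall>x\<in>T. is_tile x \<and> 0 \<le> top_depth x \<and> bot_depth x \<le> total_depth \<and>
        (\<forall>t. top_depth x < t \<longrightarrow> t < bot_depth x \<longrightarrow> path_at u t \<le> left_at x t \<and> right_at x t \<le> path_at w t)) \<and>
     pairwise slices_disjoint T \<and>
     (\<forall>t. 0 \<le> t \<longrightarrow> t \<le> total_depth \<longrightarrow> path_at u t \<le> path_at w t) \<and>
     (\<forall>t r. 0 < t \<longrightarrow> t < total_depth \<longrightarrow> path_at u t < r \<longrightarrow> r < path_at w t \<longrightarrow>
        (\<exists>x\<in>T. top_depth x \<le> t \<and> t \<le> bot_depth x \<and> left_at x t \<le> r \<and> r \<le> right_at x t))"

definition left_of :: "complex \<times> nat \<times> nat \<Rightarrow> complex \<times> nat \<times> nat \<Rightarrow> bool" where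
  "left_of x y \<longleftrightarrow> (\<exists>t. top_depth x < t \<and> t < bot_depth x \<and> top_depth y < t \<and> t < bot_depth y \<and>
     right_at x t \<le> left_at y t)"

text \<open>If the order changed, the midpoints of the two slices would coincide at some common
  depth by the intermediate value theorem, and slices of positive length with the same midpoint
  overlap.\<close>

lemma left_of_everywhere:
  assumes tiles: "is_tile x" "is_tile y" and disj: "slices_disjoint x y" and "left_of x y"
    and t: "top_depth x < t" "t < bot_depth x" "top_depth y < t" "t < bot_depth y"
  shows "right_at x t \<le> left_at y t"
proof (rule ccontr)
  assume "\<not> ?thesis"
  then have neg: "right_at y t \<le> left_at x t" using disj t by (auto simp: slices_disjoint_def)
  obtain s where s: "top_depth x < s" "s < bot_depth x" "top_depth y < s" "s < bot_depth y"
    "right_at x s \<le> left_at y s" using \<open>left_of x y\<close> by (auto simp: left_of_def)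
  let ?f = "\<lambda>t. (left_at y t + right_at y t) - (left_at x t + right_at x t)"
  have cont: "continuous_on A ?f" for A
    by (intro continuous_intros continuous_left_at continuous_right_at)
  have "?f t < 0" "0 < ?f s"
    using neg s(5) left_less_right[OF tiles(1)] left_less_right[OF tiles(2)] s t by fastforce+
  then have "\<exists>z. min s t \<le> z \<and> z \<le> max s t \<and> ?f z = 0"
  proof (cases "s \<le> t")
    case True
    then show ?thesis using IVT2'[of ?f t 0 s, OF _ _ True cont] \<open>?f t < 0\<close> \<open>0 < ?f s\<close> by auto
  next
    case False
    then show ?thesis using IVT'[of ?f t 0 s, OF _ _ _ cont] \<open>?f t < 0\<close> \<open>0 < ?f s\<close> by auto
  qed
  then obtain z where z: "min s t \<le> z" "z \<le> max s t" "?f z = 0" by blast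
  then have "top_depth x < z" "z < bot_depth x" "top_depth y < z" "z < bot_depth y" using s t
    by auto
  with disj z(3) left_less_right[OF tiles(1), of z] left_less_right[OF tiles(2), of z] show False
    unfolding slices_disjoint_def by fastforce
qed

text \<open>
  Tiles are inserted in the order of their top vertices. All older tiles that share a depth with the
  new tile \<open>x\<close> meet the horizontal line just below its top, where they are linearly ordered.
\<close>

lemma exists_leftmost_tile:
  assumes "finite T" "T \<noteq> {}" "\<And>x. x \<in> T \<Longrightarrow> is_tile x" "pairwise slices_disjoint T"
  shows "\<exists>m\<in>T. \<forall>x\<in>T. x \<noteq> m \<longrightarrow> \<not> left_of x m"
  using assms
proof (induction T rule: finite_ranking_induct[where f = top_depth])
  case (insert x S)
  show ?case
  proof (cases "S = {} \<or> x \<in> S")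
    case True
    then show ?thesis
    proof
      assume "x \<in> S"
      then have "insert x S = S" "S \<noteq> {}" by auto
      with insert.IH insert.prems show ?thesis by simp
    qed auto
  next
    case False
    have "\<exists>m\<in>S. \<forall>y\<in>S. y \<noteq> m \<longrightarrow> \<not> left_of y m"
      using insert.IH insert.prems False by (simp add: pairwise_insert)
    then obtain m where m: "m \<in> S" "\<And>y. y \<in> S \<Longrightarrow> y \<noteq> m \<Longrightarrow> \<not> left_of y m" by blast
    have tiles: "is_tile x" "is_tile m" and disj: "slices_disjoint x m" and "top_depth m \<le> top_depth x"
      using insert.prems(2,3) insert.hyps(2) m(1) False unfolding pairwise_insert by blast+
    show ?thesis
    proof (cases "left_of x m")
      case False
      then show ?thesis using m by (intro bexI[of _ m]) auto
    next
      case True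
      \<comment> \<open>The new tile \<open>x\<close> takes over from \<open>m\<close>: a tile
        \<open>y\<close> left of \<open>x\<close> would, just below the top of \<open>x\<close>,
        also be left of \<open>m\<close>.\<close>
      have "\<not> left_of y x" if y: "y \<in> S" for y
      proof
        assume yx: "left_of y x"
        have ty: "is_tile y" and dy: "slices_disjoint y x" "top_depth y \<le> top_depth x"
          using insert.prems(2,3) insert.hyps(2) y \<open>\<not> (S = {} \<or> x \<in> S)\<close>
          unfolding pairwise_insert by blast+
        have "top_depth x < bot_depth y" "top_depth x < bot_depth m"
          using yx True unfolding left_of_def by force+
        then obtain t where "top_depth x < t" "t < min (bot_depth x) (min (bot_depth y) (bot_depth m))"
          using top_less_bot[OF tiles(1)] dense by (metis min_less_iff_conj)
        then have t: "top_depth x < t" "t < bot_depth x" "t < bot_depth y" "t < bot_depth m"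
          "top_depth y < t" "top_depth m < t"
            using dy(2) \<open>top_depth m \<le> top_depth x\<close> by auto
        have "right_at y t \<le> left_at x t" "right_at x t \<le> left_at m t"
          using left_of_everywhere[OF ty tiles(1) dy(1) yx, of t] left_of_everywhere[OF tiles disj True, of t] t
          by auto
        moreover have "left_at x t < right_at x t" using left_less_right tiles t by auto
        ultimately have le: "right_at y t \<le> left_at m t" by simp
        moreover have "left_at y t < right_at y t" using left_less_right ty t by auto
        ultimately have "y \<noteq> m" by auto
        then show False using m(2)[OF y] le t unfolding left_of_def by blast
      qed
      then show ?thesis by (intro bexI[of _ x]) auto
    qed
  qed
qed simp

text \<open>A gap between the path and the tile would contain points covered by another tile, which
  would then lie to the left of \<open>m\<close>.\<close>

lemma leftmost_tile_on_path:
  assumes T: "tiles_between T u w" and m: "m \<in> T" "\<And>x. x \<in> T \<Longrightarrow> x \<noteq> m \<Longrightarrow> \<not> left_of x m"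
    and t: "top_depth m < t" "t < bot_depth m"
  shows "left_at m t = path_at u t"
proof (rule ccontr)
  assume "left_at m t \<noteq> path_at u t"
  have tile: "is_tile m" "0 \<le> top_depth m" "bot_depth m \<le> total_depth"
    and m_in: "\<And>t. top_depth m < t \<Longrightarrow> t < bot_depth m \<Longrightarrow> path_at u t \<le> left_at m t \<and> right_at m t \<le> path_at w t"
    using T m(1) unfolding tiles_between_def by blast+
  define D where "D = {t. top_depth m < t \<and> t < bot_depth m \<and> path_at u t < left_at m t}"
  have "open D" unfolding D_def
    by (intro open_Collect_conj open_Collect_less continuous_path_at continuous_left_at continuous_intros)
  moreover have "t \<in> D" using t m_in[OF t] \<open>left_at m t \<noteq> path_at u t\<close>
    by (auto simp: D_def)
  \<comment> \<open>The gap is open in the depth, so a depth can be chosen that avoids the tops and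
    bottoms of all tiles. The covering tile then meets it strictly inside its range, as
    \<open>left_of\<close> requires.\<close>
  moreover have "countable (top_depth ` T \<union> bot_depth ` T)"
    using T by (simp add: tiles_between_def countable_finite)
  ultimately obtain s where s: "s \<in> D" "s \<notin> top_depth ` T \<union> bot_depth ` T"
    using open_minus_countable[of "top_depth ` T \<union> bot_depth ` T" D] by blast
  then have sm: "top_depth m < s" "s < bot_depth m" "path_at u s < left_at m s"
    by (auto simp: D_def)
  have lr: "left_at m s < right_at m s" using left_less_right tile sm by blast
  obtain r where r: "path_at u s < r" "r < left_at m s" using sm(3) dense by blast
  have "0 < s" "s < total_depth" "r < path_at w s" using sm tile lr r m_in[of s] by auto
  then obtain x where x: "x \<in> T" "top_depth x \<le> s" "s \<le> bot_depth x" "left_at x s \<le> r" "r \<le> right_at x s"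
    using T r(1) unfolding tiles_between_def by blast
  then have xs: "top_depth x < s" "s < bot_depth x" using s(2) by (auto simp: less_le)
  have "x \<noteq> m" using x(4) r by auto
  then have "slices_disjoint x m" using T x(1) m(1) by (auto simp: tiles_between_def pairwise_def)
  then have "right_at x s \<le> left_at m s"
    using xs sm x(4) r(2) lr unfolding slices_disjoint_def by fastforce
  then show False using m(2)[OF x(1) \<open>x \<noteq> m\<close>] xs sm unfolding left_of_def
    by blast
qed

lemma contour_first:
  "i \<in> {1..n} \<Longrightarrow> j \<in> {1..n} \<Longrightarrow> - Im a \<le> t \<Longrightarrow> t \<le> - Im a + drop_of i \<Longrightarrow> contour a i j t = Re a + slope i * (t + Im a)"
  using drop_pos[of i] drop_pos[of j] by (auto simp: contour_def clamp_to_def)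

lemma contour_second:
  "i \<in> {1..n} \<Longrightarrow> j \<in> {1..n} \<Longrightarrow> - Im a + drop_of i \<le> t \<Longrightarrow> t \<le> - Im a + drop_of i + drop_of j \<Longrightarrow>
     contour a i j t = Re a + slope i * drop_of i + slope j * (t + Im a - drop_of i)"
  using drop_pos[of i] drop_pos[of j] by (auto simp: contour_def clamp_to_def)

text \<open>Each half of the contour is a unit segment on the path, hence a side of it; the second
  begins at the depth where the first ends, so the two are consecutive.\<close>

lemma tile_on_path:
  assumes u: "u permutes {1..n}" and ij: "i \<in> {1..n}" "j \<in> {1..n}"
    and range: "0 \<le> - Im a" "- Im a + drop_of i + drop_of j \<le> total_depth"
    and eq: "\<And>t. - Im a < t \<Longrightarrow> t < - Im a + drop_of i + drop_of j \<Longrightarrow> contour a i j t = path_at u t"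
  obtains p where "p \<in> {1..<n}" "a = path_vertex \<theta> u (p - 1)" "i = u p" "j = u (Suc p)"
proof -
  have pos: "0 < drop_of i" "0 < drop_of j" using ij drop_pos by auto
  have first: "path_at u t = (Re a + slope i * Im a) + slope i * t"
    if "- Im a < t" "t < - Im a + drop_of i" for t
    using eq[of t] contour_first[OF ij, of a t] that pos by (auto simp: algebra_simps)
  have "- Im a + drop_of i \<le> total_depth" "0 \<le> - Im a + drop_of i" using range pos by auto
  note range' = this
  obtain p where p: "p \<in> {1..n}" "u p = i" "depth u (p - 1) = - Im a"
    using path_at_linear_imp_side[OF u ij(1) range(1) range'(1) first] by blast
  have second: "path_at u t = (Re a + slope i * drop_of i + slope j * (Im a - drop_of i)) + slope j * t"
    if "- Im a + drop_of i < t" "t < - Im a + drop_of i + drop_of j" for t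
    using eq[of t] contour_second[OF ij, of a t] that pos by (auto simp: algebra_simps)
  obtain q where q: "q \<in> {1..n}" "u q = j" "depth u (q - 1) = - Im a + drop_of i"
    using path_at_linear_imp_side[OF u ij(2) range'(2) range(2) second] by blast
  have "depth u (q - 1) = depth u p" using p q depth_pred[of p u] by auto
  then have "q = Suc p" using depth_eq_iff[OF u, of "q - 1" p] p(1) q(1) by auto
  obtain t where t: "- Im a < t" "t < - Im a + drop_of i" using pos dense
    by (metis less_add_same_cancel1)
  have "Re a = Re (path_vertex \<theta> u (p - 1))"
    using path_at_on_side[OF u p(1), of t] eq[of t] contour_first[OF ij, of a t] t pos p depth_pred[of p u] by auto
  then have "a = path_vertex \<theta> u (p - 1)" using p(3) by (simp add: complex_eq_iff)
  with that[of p] p q \<open>q = Suc p\<close> show ?thesis by auto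
qed

section \<open>Exchanging two consecutive sides of a path\<close>

abbreviation swap_at :: "(nat \<Rightarrow> nat) \<Rightarrow> nat \<Rightarrow> nat \<Rightarrow> nat" where
  "swap_at u p \<equiv> u \<circ> Transposition.transpose p (Suc p)"

definition path_tile :: "(nat \<Rightarrow> nat) \<Rightarrow> nat \<Rightarrow> complex \<times> nat \<times> nat" where
  "path_tile u p = (path_vertex \<theta> u (p - 1), u p, u (Suc p))"

lemma swap_at_permutes:
  "u permutes {1..n} \<Longrightarrow> p \<in> {1..<n} \<Longrightarrow> swap_at u p permutes {1..n}"
  by (intro permutes_compose permutes_swap_id) auto

text \<open>The transposition permutes every prefix except the one that ends at \<open>p\<close>. So
  only the vertex between the two exchanged sides moves.\<close>

lemma sum_swap_at:
  assumes "k \<noteq> p" "1 \<le> p"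
  shows "(\<Sum>i=1..k. f (swap_at u p i)) = (\<Sum>i=1..k. f (u i))"
proof (cases "k < p")
  case True
  then show ?thesis by (intro sum.cong) (auto simp: Transposition.transpose_def)
next
  case False
  then have "Transposition.transpose p (Suc p) permutes {1..k}" using assms
    by (intro permutes_swap_id) auto
  then show ?thesis using sum.permute[of "Transposition.transpose p (Suc p)" "{1..k}" "\<lambda>i. f (u i)"] by (simp add: o_def)
qed

lemma depth_swap_at: "k \<noteq> p \<Longrightarrow> 1 \<le> p \<Longrightarrow> depth (swap_at u p) k = depth u k"
  unfolding depth_def by (rule sum_swap_at)

lemma path_vertex_swap_at: "k \<noteq> p \<Longrightarrow> 1 \<le> p \<Longrightarrow> path_vertex \<theta> (swap_at u p) k = path_vertex \<theta> u k"
  unfolding path_vertex_def by (rule sum_swap_at)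

context
  fixes u p assumes u: "u permutes {1..n}" and p: "p \<in> {1..<n}" and asc: "u p < u (Suc p)"
begin

lemma labels_in: "u p \<in> {1..n}" "u (Suc p) \<in> {1..n}"
  using perm_in[OF u, of p] perm_in[OF u, of "Suc p"] p by auto

lemma is_tile_path_tile: "is_tile (path_tile u p)"
  using labels_in asc by (simp add: path_tile_def is_tile_def)

lemma top_path_tile: "top_depth (path_tile u p) = depth u (p - 1)"
  and bot_path_tile: "bot_depth (path_tile u p) = depth u (Suc p)"
  using p depth_pred[of p u] by (auto simp: path_tile_def tile_defs depth_Suc)

lemma path_tile_range: "0 \<le> top_depth (path_tile u p)" "bot_depth (path_tile u p) \<le> total_depth"
  unfolding top_path_tile bot_path_tile
    using depth_bounds[OF u, of "p - 1"] depth_bounds[OF u, of "Suc p"] p by auto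

lemma left_path_tile:
  assumes "top_depth (path_tile u p) \<le> t" "t \<le> bot_depth (path_tile u p)"
  shows "left_at (path_tile u p) t = path_at u t"
proof (cases "t \<le> depth u p")
  case True
  then show ?thesis using assms p depth_pred[of p u] contour_first[OF labels_in, of "path_vertex \<theta> u (p - 1)" t]
      path_at_on_side[OF u, of p t] unfolding top_path_tile bot_path_tile
    by (auto simp: path_tile_def left_at_def)
next
  case False
  have "Re (path_vertex \<theta> u p) = Re (path_vertex \<theta> u (p - 1)) + slope (u p) * drop_of (u p)"
    using p labels_in by (cases p) (auto simp: path_vertex_def)
  then show ?thesis
    using False assms p depth_pred[of p u] contour_second[OF labels_in, of "path_vertex \<theta> u (p - 1)" t]
      path_at_on_side[OF u, of "Suc p" t] unfolding top_path_tile bot_path_tile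
    by (auto simp: path_tile_def left_at_def depth_Suc algebra_simps)
qed

text \<open>Only the terms of the two exchanged sides differ. The identity holds at every depth
  thanks to the constant extension of the contours.\<close>

lemma path_at_swap_at:
  "path_at (swap_at u p) t - path_at u t = right_at (path_tile u p) t - left_at (path_tile u p) t"
proof -
  let ?g = "\<lambda>u k. slope (u k) * clamp_to (drop_of (u k)) (t - depth u (k - 1))"
  let ?v = "swap_at u p"
  have "path_at ?v t - path_at u t = (\<Sum>k=1..n. ?g ?v k - ?g u k)"
    by (simp add: path_at_def sum_subtractf)
  also have "\<dots> = (\<Sum>k\<in>{p, Suc p}. ?g ?v k - ?g u k)"
  proof (rule sum.mono_neutral_right)
    show "\<forall>k\<in>{1..n} - {p, Suc p}. ?g ?v k - ?g u k = 0"
    proof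
      fix k assume k: "k \<in> {1..n} - {p, Suc p}"
      then have "?v k = u k" "k - 1 \<noteq> p" by (auto simp: Transposition.transpose_def)
      then show "?g ?v k - ?g u k = 0" using depth_swap_at[of "k - 1" p u] p by simp
    qed
  qed (use p in auto)
  also have "\<dots> = right_at (path_tile u p) t - left_at (path_tile u p) t"
  proof -
    have "depth ?v (p - 1) = depth u (p - 1)" "depth ?v p = depth u (p - 1) + drop_of (u (Suc p))"
      using depth_swap_at[of "p - 1" p u] depth_pred[of p ?v] p by auto
    moreover have "depth u p = depth u (p - 1) + drop_of (u p)" using depth_pred[of p u] p by auto
    ultimately show ?thesis by (simp add: path_tile_def tile_defs contour_def diff_diff_eq)
  qed
  finally show ?thesis .
qed

lemma path_at_swap_at_outside:
  assumes "t \<le> top_depth (path_tile u p) \<or> bot_depth (path_tile u p) \<le> t"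
  shows "path_at (swap_at u p) t = path_at u t"
proof -
  have "right_at (path_tile u p) t = left_at (path_tile u p) t"
    using assms drop_pos[OF labels_in(1)] drop_pos[OF labels_in(2)]
    by (auto simp: path_tile_def tile_defs contour_def clamp_to_def)
  then show ?thesis using path_at_swap_at[of t] by simp
qed

lemma right_path_tile:
  assumes "top_depth (path_tile u p) \<le> t" "t \<le> bot_depth (path_tile u p)"
  shows "right_at (path_tile u p) t = path_at (swap_at u p) t"
  using path_at_swap_at[of t] left_path_tile[OF assms] by simp

lemma path_at_le_swap_at: "path_at u t \<le> path_at (swap_at u p) t"
  using path_at_swap_at[of t] path_at_swap_at_outside[of t] left_less_right[OF is_tile_path_tile, of t]
  by (cases "t \<le> top_depth (path_tile u p) \<or> bot_depth (path_tile u p) \<le> t") auto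

lemma tiles_between_single: "tiles_between {path_tile u p} u (swap_at u p)"
proof -
  have "\<exists>x\<in>{path_tile u p}. top_depth x \<le> t \<and> t \<le> bot_depth x \<and> left_at x t \<le> r \<and> r \<le> right_at x t"
    if "path_at u t < r" "r < path_at (swap_at u p) t" for t r
  proof -
    have "\<not> (t \<le> top_depth (path_tile u p) \<or> bot_depth (path_tile u p) \<le> t)"
      using path_at_swap_at_outside[of t] that by auto
    then show ?thesis using left_path_tile[of t] right_path_tile[of t] that by auto
  qed
  then show ?thesis unfolding tiles_between_def
    using is_tile_path_tile path_tile_range left_path_tile right_path_tile path_at_le_swap_at
    by auto
qed

lemma tiles_between_remove:
  assumes T: "tiles_between T u w" and m: "path_tile u p \<in> T"
    and leftmost: "\<And>x. x \<in> T \<Longrightarrow> x \<noteq> path_tile u p \<Longrightarrow> \<not> left_of x (path_tile u p)"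
  shows "tiles_between (T - {path_tile u p}) (swap_at u p) w"
  unfolding tiles_between_def
proof (intro conjI ballI allI impI)
  let ?m = "path_tile u p"
  show "finite (T - {?m})" "pairwise slices_disjoint (T - {?m})"
    using T by (auto simp: tiles_between_def pairwise_def)
  have m_in: "\<And>t. top_depth ?m < t \<Longrightarrow> t < bot_depth ?m \<Longrightarrow> right_at ?m t \<le> path_at w t"
    using T m unfolding tiles_between_def by blast
  show "path_at (swap_at u p) t \<le> path_at w t" if "0 \<le> t" "t \<le> total_depth" for t
    using that T right_path_tile[of t] m_in[of t] path_at_swap_at_outside[of t]
    unfolding tiles_between_def
    by (cases "t \<le> top_depth (path_tile u p) \<or> bot_depth (path_tile u p) \<le> t") auto
  fix x assume x: "x \<in> T - {?m}"
  then show "is_tile x" "0 \<le> top_depth x" "bot_depth x \<le> total_depth" using T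
    by (auto simp: tiles_between_def)
  fix t assume t: "top_depth x < t" "t < bot_depth x"
  have px: "path_at u t \<le> left_at x t" using t T x by (auto simp: tiles_between_def)
  show "right_at x t \<le> path_at w t" using t T x by (auto simp: tiles_between_def)
  show "path_at (swap_at u p) t \<le> left_at x t"
  proof (cases "t \<le> top_depth ?m \<or> bot_depth ?m \<le> t")
    case True
    then show ?thesis using px path_at_swap_at_outside by simp
  next
    case False
    have "slices_disjoint x ?m" using T x m by (auto simp: tiles_between_def pairwise_def)
    \<comment> \<open>Disjointness allows two orders; the one with \<open>x\<close> on the left is
      excluded by the choice of the removed tile.\<close>
    then have "right_at ?m t \<le> left_at x t"
      using leftmost[of x] x False t unfolding slices_disjoint_def left_of_def by force
    then show ?thesis using right_path_tile[of t] False by auto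
  qed
next
  let ?m = "path_tile u p"
  fix t r assume t: "0 < t" "t < total_depth" and r: "path_at (swap_at u p) t < r" "r < path_at w t"
  then obtain x where x: "x \<in> T" "top_depth x \<le> t" "t \<le> bot_depth x" "left_at x t \<le> r" "r \<le> right_at x t"
    using T path_at_le_swap_at[of t] unfolding tiles_between_def by (meson le_less_trans)
  moreover have "x \<noteq> ?m" using x right_path_tile[of t] r by auto
  ultimately show "\<exists>x\<in>T - {?m}. top_depth x \<le> t \<and> t \<le> bot_depth x \<and> left_at x t \<le> r \<and> r \<le> right_at x t"
    by blast
qed

end

lemma tiles_between_append:
  assumes T: "tiles_between T u v" and T': "tiles_between T' v w"
  shows "tiles_between (T \<union> T') u w"
  unfolding tiles_between_def
proof (intro conjI ballI allI impI)
  have le: "path_at u t \<le> path_at v t" "path_at v t \<le> path_at w t"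
    if "0 \<le> t" "t \<le> total_depth" for t
    using T T' that unfolding tiles_between_def by blast+
  show "finite (T \<union> T')" using T T' by (auto simp: tiles_between_def)
  have cross: "slices_disjoint x y \<and> slices_disjoint y x" if xy: "x \<in> T" "y \<in> T'"
    for x y
  proof -
    have "right_at x t \<le> left_at y t"
      if "top_depth x < t" "t < bot_depth x" "top_depth y < t" "t < bot_depth y" for t
    proof (rule order_trans)
      show "right_at x t \<le> path_at v t" using T xy(1) that(1,2) unfolding tiles_between_def
        by blast
      show "path_at v t \<le> left_at y t" using T' xy(2) that(3,4) unfolding tiles_between_def
        by blast
    qed
    then show ?thesis unfolding slices_disjoint_def by blast
  qed
  have "pairwise slices_disjoint T" "pairwise slices_disjoint T'"
    using T T' unfolding tiles_between_def by blast+
  then show "pairwise slices_disjoint (T \<union> T')"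
    using cross unfolding pairwise_def by blast
  show "path_at u t \<le> path_at w t" if "0 \<le> t" "t \<le> total_depth" for t using le[OF that]
    by simp
  fix x assume x: "x \<in> T \<union> T'"
  then show *: "is_tile x" "0 \<le> top_depth x" "bot_depth x \<le> total_depth"
    using T T' by (auto simp: tiles_between_def)
  fix t assume t: "top_depth x < t" "t < bot_depth x"
  then have "path_at u t \<le> path_at v t" "path_at v t \<le> path_at w t" using * le[of t] by auto
  moreover have "path_at u t \<le> left_at x t \<and> right_at x t \<le> path_at v t \<or>
      path_at v t \<le> left_at x t \<and> right_at x t \<le> path_at w t"
    using x T T' t unfolding tiles_between_def by blast
  ultimately show "path_at u t \<le> left_at x t" "right_at x t \<le> path_at w t" by auto
next
  fix t r assume t: "0 < t" "t < total_depth" and r: "path_at u t < r" "r < path_at w t"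
  show "\<exists>x\<in>T \<union> T'. top_depth x \<le> t \<and> t \<le> bot_depth x \<and> left_at x t \<le> r \<and> r \<le> right_at x t"
  proof (cases "path_at v t < r")
    case True
    then show ?thesis using t r T' unfolding tiles_between_def by blast
  next
    case False
    \<comment> \<open>The point may lie exactly on the middle path, where neither family promises
      coverage. The slices of \<open>T\<close> at this depth form a finite union of closed intervals
      that contains all points just to its left, hence the point itself.\<close>
    let ?K = "\<Union>x\<in>{x \<in> T. top_depth x \<le> t \<and> t \<le> bot_depth x}. {left_at x t..right_at x t}"
    have "closed ?K" using T by (intro closed_UN) (auto simp: tiles_between_def)
    moreover have "{path_at u t<..<r} \<subseteq> ?K"
    proof
      fix s assume "s \<in> {path_at u t<..<r}"
      then have "path_at u t < s" "s < path_at v t" using False by auto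
      then obtain x where "x \<in> T" "top_depth x \<le> t" "t \<le> bot_depth x" "left_at x t \<le> s" "s \<le> right_at x t"
        using T t unfolding tiles_between_def by blast
      then show "s \<in> ?K" by (intro UN_I[of x]) simp_all
    qed
    ultimately have "closure {path_at u t<..<r} \<subseteq> ?K" by (rule closure_minimal[rotated])
    moreover have "r \<in> closure {path_at u t<..<r}" using r(1) by simp
    ultimately have "r \<in> ?K" by (rule subsetD)
    then obtain x where "x \<in> T" "top_depth x \<le> t" "t \<le> bot_depth x" "r \<in> {left_at x t..right_at x t}"
      by blast
    then show ?thesis by (intro bexI[of _ x]) simp_all
  qed
qed

section \<open>Inversions and chains in the weak order\<close>

definition inversions :: "(nat \<Rightarrow> nat) \<Rightarrow> (nat \<times> nat) set" where
  "inversions u = {(i, j). i \<in> {1..n} \<and> j \<in> {1..n} \<and> i < j \<and> inv u j < inv u i}"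

lemma finite_inversions: "finite (inversions u)"
  by (rule finite_subset[of _ "{1..n} \<times> {1..n}"]) (auto simp: inversions_def)

lemma inversions_id [simp]: "inversions id = {}"
  by (auto simp: inversions_def)

text \<open>Inversions are pairs of labels, not of positions, so that each exchange adds exactly the
  label pair of the tile it sweeps over and all others persist.\<close>

lemma inversions_swap_at:
  assumes u: "u permutes {1..n}" and p: "p \<in> {1..<n}" and asc: "u p < u (Suc p)"
  shows "inversions (swap_at u p) = insert (u p, u (Suc p)) (inversions u)"
    and "(u p, u (Suc p)) \<notin> inversions u"
proof -
  let ?t = "Transposition.transpose p (Suc p)"
  have bij: "bij u" using permutes_bij[OF u] .
  have inv: "inv (swap_at u p) k = ?t (inv u k)" for k
    using o_inv_distrib[OF bij, of ?t] by simp
  have at: "inv u k = q \<longleftrightarrow> k = u q" for k q using permutes_inv_eq[OF u] by auto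
  have t: "?t (Suc p) < ?t p" "\<not> ?t p < ?t (Suc p)" by (auto simp: Transposition.transpose_def)
  have key: "?t (inv u j) < ?t (inv u i) \<longleftrightarrow>
      (i = u p \<and> j = u (Suc p)) \<or> (inv u j < inv u i \<and> \<not> (i = u (Suc p) \<and> j = u p))" for i j
  proof (cases "inv u i = p \<and> inv u j = Suc p \<or> inv u i = Suc p \<and> inv u j = p")
    case True
    then show ?thesis using at[of i p] at[of j "Suc p"] at[of j p] at[of i "Suc p"] asc t
      by (elim disjE conjE) (simp_all only:, auto)
  next
    case False
    then have "?t (inv u j) < ?t (inv u i) \<longleftrightarrow> inv u j < inv u i"
      by (auto simp: Transposition.transpose_def)
    then show ?thesis using False at[of i p] at[of j "Suc p"] at[of j p] at[of i "Suc p"] by blast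
  qed
  have labels: "u p \<in> {1..n}" "u (Suc p) \<in> {1..n}"
    using perm_in[OF u, of p] perm_in[OF u, of "Suc p"] p by auto
  show "inversions (swap_at u p) = insert (u p, u (Suc p)) (inversions u)"
    unfolding inversions_def inv key using labels asc by auto
  show "(u p, u (Suc p)) \<notin> inversions u"
    using at[of "u p" p] at[of "u (Suc p)" "Suc p"] by (simp add: inversions_def)
qed

text \<open>Without tiles nothing lies strictly between the paths, so they coincide; equal paths
  have equal sides, read off one after another from the top.\<close>

lemma tiles_between_empty:
  assumes u: "u permutes {1..n}" and w: "w permutes {1..n}" and T: "tiles_between {} u w"
  shows "u = w"
proof -
  have eq: "path_at u t = path_at w t" if "0 < t" "t < total_depth" for t
  proof (rule antisym)
    show "path_at u t \<le> path_at w t" using T that by (auto simp: tiles_between_def)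
    show "path_at w t \<le> path_at u t"
      using T that dense[of "path_at u t" "path_at w t"] by (force simp: tiles_between_def)
  qed
  have "p \<le> n \<Longrightarrow> \<forall>q\<in>{1..p}. w q = u q" for p
  proof (induction p)
    case (Suc p)
    then have IH: "\<forall>q\<in>{1..p}. w q = u q" by simp
    have dp: "depth w p = depth u p" unfolding depth_def using IH by (intro sum.cong) auto
    have up: "u (Suc p) \<in> {1..n}" using perm_in[OF u, of "Suc p"] Suc.prems by auto
    have range: "0 \<le> depth u p" "depth u p + drop_of (u (Suc p)) \<le> total_depth"
      using depth_bounds[OF u, of p] depth_bounds[OF u, of "Suc p"] Suc.prems
      by (auto simp: depth_Suc)
    have lin: "path_at w t = (Re (path_vertex \<theta> u p) - slope (u (Suc p)) * depth u p) + slope (u (Suc p)) * t"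
      if "depth u p < t" "t < depth u p + drop_of (u (Suc p))" for t
      using path_at_on_side[OF u, of "Suc p" t] eq[of t] that range Suc.prems
      by (auto simp: depth_Suc algebra_simps)
    obtain q where q: "q \<in> {1..n}" "w q = u (Suc p)" "depth w (q - 1) = depth u p"
      using path_at_linear_imp_side[OF w up range lin] by blast
    then have "q - 1 = p" using depth_eq_iff[OF w, of "q - 1" p] dp Suc.prems by auto
    then have "q = Suc p" using q(1) by auto
    then show ?case using q IH by (auto simp: le_Suc_eq)
  qed simp
  from this[of n] show ?thesis using u w by (metis ext le_refl permutes_not_in)
qed

lemma exists_flippable_leftmost_tile:
  assumes u: "u permutes {1..n}" and T: "tiles_between T u w" "T \<noteq> {}"
  obtains p where "p \<in> {1..<n}" "u p < u (Suc p)" "path_tile u p \<in> T"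
    "tiles_between (T - {path_tile u p}) (swap_at u p) w"
proof -
  have fin: "finite T" "\<And>x. x \<in> T \<Longrightarrow> is_tile x" "pairwise slices_disjoint T"
    using T(1) unfolding tiles_between_def by blast+
  obtain m where m: "m \<in> T" "\<And>x. x \<in> T \<Longrightarrow> x \<noteq> m \<Longrightarrow> \<not> left_of x m"
    using exists_leftmost_tile[OF fin(1) T(2) fin(2,3)] by blast
  obtain a i j where mf: "m = (a, i, j)" by (cases m)
  have ij: "i \<in> {1..n}" "j \<in> {1..n}" "i < j" using fin(2)[OF m(1)] mf
    by (auto simp: is_tile_def)
  have "0 \<le> top_depth m" "bot_depth m \<le> total_depth" using T(1) m(1)
    by (auto simp: tiles_between_def)
  then have range: "0 \<le> - Im a" "- Im a + drop_of i + drop_of j \<le> total_depth"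
    unfolding mf top_depth_def bot_depth_def by auto
  have eq: "contour a i j t = path_at u t" if "- Im a < t" "t < - Im a + drop_of i + drop_of j"
    for t
    using leftmost_tile_on_path[OF T(1) m, of t] that by (simp add: mf tile_defs)
  obtain p where p: "p \<in> {1..<n}" "a = path_vertex \<theta> u (p - 1)" "i = u p" "j = u (Suc p)"
    using tile_on_path[OF u ij(1,2) range eq] by blast
  then have "m = path_tile u p" using mf by (simp add: path_tile_def)
  with that[OF p(1)] tiles_between_remove[OF u p(1) _ T(1)] m ij(3) p show ?thesis by blast
qed

text \<open>
  Removing leftmost tiles one by one turns \<open>u\<close> into \<open>w\<close>, each removal creating the inversion given by
  the labels of the tile.
\<close>

theorem tiles_between_structure:
  assumes "u permutes {1..n}" "w permutes {1..n}" "tiles_between T u w"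
  shows "inversions u \<subseteq> inversions w"
    and "(a, i, j) \<in> T \<Longrightarrow> (i, j) \<in> inversions w"
    and "T \<noteq> {} \<Longrightarrow> \<exists>p\<in>{1..<n}. w (Suc p) < w p \<and> path_tile (swap_at w p) p \<in> T"
proof -
  have "finite T" using assms(3) by (simp add: tiles_between_def)
  then have "inversions u \<subseteq> inversions w \<and> (\<forall>a i j. (a, i, j) \<in> T \<longrightarrow> (i, j) \<in> inversions w) \<and>
     (T \<noteq> {} \<longrightarrow> (\<exists>p\<in>{1..<n}. w (Suc p) < w p \<and> path_tile (swap_at w p) p \<in> T))"
    using assms
  proof (induction T arbitrary: u rule: finite_psubset_induct)
    case (psubset T)
    show ?case
    proof (cases "T = {}")
      case True
      then show ?thesis using tiles_between_empty psubset.prems by blast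
    next
      case False
      obtain p where p: "p \<in> {1..<n}" "u p < u (Suc p)" "path_tile u p \<in> T"
        "tiles_between (T - {path_tile u p}) (swap_at u p) w"
        using exists_flippable_leftmost_tile[OF psubset.prems(1,3) False] by blast
      let ?T = "T - {path_tile u p}" and ?v = "swap_at u p"
      have v: "?v permutes {1..n}" using swap_at_permutes[OF psubset.prems(1) p(1)] .
      have IH: "inversions ?v \<subseteq> inversions w" "\<forall>a i j. (a, i, j) \<in> ?T \<longrightarrow> (i, j) \<in> inversions w"
        "?T \<noteq> {} \<longrightarrow> (\<exists>p\<in>{1..<n}. w (Suc p) < w p \<and> path_tile (swap_at w p) p \<in> ?T)"
        using psubset.IH[OF _ v psubset.prems(2) p(4)] p(3) by blast+
      have inv: "insert (u p, u (Suc p)) (inversions u) \<subseteq> inversions w"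
        using IH(1) inversions_swap_at(1)[OF psubset.prems(1) p(1,2)] by simp
      have "(i, j) \<in> inversions w" if "(a, i, j) \<in> T" for a i j
        using IH(2) that inv by (cases "(a, i, j) = path_tile u p") (auto simp: path_tile_def)
      moreover have "\<exists>p\<in>{1..<n}. w (Suc p) < w p \<and> path_tile (swap_at w p) p \<in> T"
      proof (cases "?T = {}")
        case True
        \<comment> \<open>The removed tile was the last of the chain, so its right contour runs
          along the path of \<open>w\<close> itself.\<close>
        then have vw: "?v = w" using tiles_between_empty[OF v psubset.prems(2)] p(4) unfolding True
          by simp
        have "swap_at w p = u" unfolding vw[symmetric] by (simp add: o_assoc[symmetric])
        moreover have "w (Suc p) = u p" "w p = u (Suc p)" unfolding vw[symmetric] by auto
        ultimately show ?thesis using p by auto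
      next
        case False
        then show ?thesis using IH(3) by blast
      qed
      ultimately show ?thesis using inv by blast
    qed
  qed
  then show "inversions u \<subseteq> inversions w" "(a, i, j) \<in> T \<Longrightarrow> (i, j) \<in> inversions w"
    "T \<noteq> {} \<Longrightarrow> \<exists>p\<in>{1..<n}. w (Suc p) < w p \<and> path_tile (swap_at w p) p \<in> T" by blast+
qed

text \<open>As long as some adjacent ascent of \<open>u\<close> is an inversion of \<open>w\<close>,
  exchanging it leads closer to \<open>w\<close>. When none is left, \<open>inv w \<circ> u\<close>
  is increasing, hence the identity.\<close>

lemma exists_tiles_between:
  assumes "u permutes {1..n}" "w permutes {1..n}" "inversions u \<subseteq> inversions w"
  shows "\<exists>T. tiles_between T u w"
  using assms
proof (induction "card (inversions w - inversions u)" arbitrary: u rule: less_induct)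
  case less
  note u = less.prems(1) and w = less.prems(2)
  show ?case
  proof (cases "\<exists>p\<in>{1..<n}. u p < u (Suc p) \<and> (u p, u (Suc p)) \<in> inversions w")
    case True
    then obtain p where p: "p \<in> {1..<n}" "u p < u (Suc p)" "(u p, u (Suc p)) \<in> inversions w"
      by blast
    note inv = inversions_swap_at[OF u p(1,2)]
    have "inversions w - inversions (swap_at u p) \<subset> inversions w - inversions u"
      using inv p(3) by blast
    then have "card (inversions w - inversions (swap_at u p)) < card (inversions w - inversions u)"
      by (intro psubset_card_mono) (simp_all add: finite_inversions)
    moreover have "inversions (swap_at u p) \<subseteq> inversions w" unfolding inv(1)
      using p(3) less.prems(3) by simp
    ultimately obtain T where "tiles_between T (swap_at u p) w"
      using less.hyps[of "swap_at u p"] swap_at_permutes[OF u p(1)] w by blast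
    then show ?thesis using tiles_between_append[OF tiles_between_single[OF u p(1,2)]] by blast
  next
    case False
    have iw: "inv w permutes {1..n}" using permutes_inv[OF w] .
    have "inv w \<circ> u = id"
    proof (rule increasing_permutation_eq_id)
      show "inv w \<circ> u permutes {1..n}" by (rule permutes_compose[OF u iw])
      fix k assume k: "k \<in> {1..<n}"
      have labels: "u k \<in> {1..n}" "u (Suc k) \<in> {1..n}"
        using perm_in[OF u, of k] perm_in[OF u, of "Suc k"] k by auto
      have ne: "u k \<noteq> u (Suc k)" using permutes_inj[OF u] by (metis injD n_not_Suc_n)
      then have ne': "inv w (u k) \<noteq> inv w (u (Suc k))" using permutes_inj[OF iw]
        by (metis injD)
      show "(inv w \<circ> u) k < (inv w \<circ> u) (Suc k)"
      proof (cases "u k < u (Suc k)")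
        case True
        then have "(u k, u (Suc k)) \<notin> inversions w" using False k by blast
        then show ?thesis using True labels ne' by (auto simp: inversions_def)
      next
        case False
        then have "(u (Suc k), u k) \<in> inversions u"
          using labels ne by (auto simp: inversions_def permutes_inverses[OF u])
        then have "(u (Suc k), u k) \<in> inversions w" using less.prems(3) by blast
        then show ?thesis by (simp add: inversions_def)
      qed
    qed
    then have "u = w" by (metis comp_apply eq_id_iff ext permutes_inverses(1)[OF w])
    then have "tiles_between {} u w" by (simp add: tiles_between_def)
    then show ?thesis by blast
  qed
qed

section \<open>Rhombic tilings and perimeter tiles\<close>

lemma left_le_right:
  assumes "is_tile x" "top_depth x \<le> t" "t \<le> bot_depth x"
  shows "left_at x t \<le> right_at x t"
  using left_less_right[OF assms(1), of t] left_right_top[OF assms(1)] left_right_bot[OF assms(1)] assms(2,3)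
  by (cases "t = top_depth x \<or> t = bot_depth x") auto

lemma tiles_between_if_rhombic_tiling:
  assumes n: "1 \<le> n" and w: "w permutes {1..n}" and T: "rhombic_tiling n \<theta> w T"
  obtains T' where "tiles_between T' id w" "T = rhombus ` T'"
proof -
  define f where "f R = (SOME x. is_tile x \<and> R = rhombus x)" for R
  have f: "is_tile (f R)" "rhombus (f R) = R" if "R \<in> T" for R
  proof -
    have "\<exists>x. is_tile x \<and> R = rhombus x" using T that rhombic_tile_iff
      by (auto simp: rhombic_tiling_def)
    from someI_ex[OF this] show "is_tile (f R)" "rhombus (f R) = R" by (auto simp: f_def)
  qed
  have X: "\<Union>T = {z. 0 \<le> - Im z \<and> - Im z \<le> total_depth \<and>
      path_at id (- Im z) \<le> Re z \<and> Re z \<le> path_at w (- Im z)}"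
    using T elnitsky_polygon_eq[OF n w] by (simp add: rhombic_tiling_def)
  have inside: "0 \<le> t \<and> t \<le> total_depth \<and> path_at id t \<le> left_at (f R) t \<and> right_at (f R) t \<le> path_at w t"
    if R: "R \<in> T" and t: "top_depth (f R) \<le> t" "t \<le> bot_depth (f R)" for R t
  proof -
    have "Complex (left_at (f R) t) (- t) \<in> rhombus (f R)" "Complex (right_at (f R) t) (- t) \<in> rhombus (f R)"
      using left_le_right[OF f(1)[OF R] t] t by (simp_all add: rhombus_eq[OF f(1)[OF R]])
    then have "Complex (left_at (f R) t) (- t) \<in> \<Union>T" "Complex (right_at (f R) t) (- t) \<in> \<Union>T"
      using f(2)[OF R] R by blast+
    then show ?thesis unfolding X by simp
  qed
  have "tiles_between (f ` T) id w" unfolding tiles_between_def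
  proof (intro conjI ballI allI impI)
    show "finite (f ` T)" using T by (simp add: rhombic_tiling_def)
    show "pairwise slices_disjoint (f ` T)"
    proof (rule pairwiseI)
      fix x y assume "x \<in> f ` T" "y \<in> f ` T" "x \<noteq> y"
      then obtain R S where RS: "R \<in> T" "S \<in> T" "x = f R" "y = f S" "R \<noteq> S" by blast
      then have "interior R \<inter> interior S = {}" using T
        by (auto simp: rhombic_tiling_def pairwise_def)
      then show "slices_disjoint x y" using interiors_disjoint_iff f RS by metis
    qed
    show "path_at id t \<le> path_at w t" if "0 \<le> t" "t \<le> total_depth" for t
      using path_at_id_le_total[OF n w that] .
    fix x assume "x \<in> f ` T"
    then obtain R where R: "R \<in> T" "x = f R" by blast
    show tile: "is_tile x" using f(1) R by simp
    show "0 \<le> top_depth x" "bot_depth x \<le> total_depth"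
      using inside[OF R(1), of "top_depth x"] inside[OF R(1), of "bot_depth x"] top_less_bot[OF tile] R(2) by auto
    fix t assume "top_depth x < t" "t < bot_depth x"
    then show "path_at id t \<le> left_at x t" "right_at x t \<le> path_at w t"
      using inside[OF R(1), of t] R(2) by auto
  next
    fix t r assume "0 < t" "t < total_depth" "path_at id t < r" "r < path_at w t"
    then have "Complex r (- t) \<in> \<Union>T" unfolding X by simp
    then obtain R where R: "R \<in> T" "Complex r (- t) \<in> R" by blast
    then have "Complex r (- t) \<in> rhombus (f R)" using f(2) by simp
    then show "\<exists>x\<in>f ` T. top_depth x \<le> t \<and> t \<le> bot_depth x \<and> left_at x t \<le> r \<and> r \<le> right_at x t"
      using R(1) by (intro bexI[of _ "f R"]) (simp_all add: rhombus_eq[OF f(1)[OF R(1)]])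
  qed
  moreover have "T = rhombus ` f ` T" using f(2) by (force simp: image_image)
  ultimately show ?thesis by (rule that)
qed

lemma interior_rhombus_nonempty: "is_tile x \<Longrightarrow> interior (rhombus x) \<noteq> {}"
proof -
  assume x: "is_tile x"
  obtain t where t: "top_depth x < t" "t < bot_depth x" using top_less_bot[OF x] dense by blast
  obtain r where "left_at x t < r" "r < right_at x t" using left_less_right[OF x t] dense by blast
  then have "Complex r (- t) \<in> interior (rhombus x)" using t
    by (simp add: interior_rhombus[OF x])
  then show ?thesis by blast
qed

text \<open>Allows tiles to be counted through their triples: distinct triples have disjoint
  nonempty interiors.\<close>

lemma inj_on_rhombus: "tiles_between T u w \<Longrightarrow> inj_on rhombus T"
proof (rule inj_onI, rule ccontr)
  fix x y assume T: "tiles_between T u w" and xy: "x \<in> T" "y \<in> T" "rhombus x = rhombus y" "x \<noteq> y"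
  have "is_tile x" "is_tile y" "slices_disjoint x y" using T xy
    by (auto simp: tiles_between_def pairwise_def)
  then have "interior (rhombus x) \<inter> interior (rhombus y) = {}" using interiors_disjoint_iff
    by blast
  then show False using xy(3) interior_rhombus_nonempty[OF \<open>is_tile x\<close>] by simp
qed

text \<open>Coverage of the open region must be raised to the closed polygon. Irreducibility gives
  every slice at an inner depth positive width, so it is the closure of its covered open part.
  Conversely, each tile is the closure of its interior and stays inside the closed region.\<close>

lemma rhombic_tiling_if_tiles_between:
  assumes n: "2 \<le> n" and w: "w permutes {1..n}"
    and irred: "\<forall>r\<in>{1..<n}. w ` {1..r} \<noteq> {1..r}"
    and T: "tiles_between T id w"
  shows "rhombic_tiling n \<theta> w (rhombus ` T)"
proof -
  have n1: "1 \<le> n" using n by simp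
  have fin: "finite T" "\<And>x. x \<in> T \<Longrightarrow> is_tile x" using T
    unfolding tiles_between_def by blast+
  let ?X = "{z. 0 \<le> - Im z \<and> - Im z \<le> total_depth \<and> path_at id (- Im z) \<le> Re z \<and> Re z \<le> path_at w (- Im z)}"
  have im: "continuous_on UNIV (\<lambda>z. - Im z)" by (intro continuous_intros)
  have c: "continuous_on UNIV (\<lambda>z. path_at u (- Im z))" for u
    using continuous_on_compose2[OF continuous_path_at[of UNIV u] im] by simp
  have closed_X: "closed ?X" by (intro closed_Collect_conj closed_Collect_le c continuous_intros)
  have "rhombus x \<subseteq> ?X" if x: "x \<in> T" for x
  proof -
    have tile: "is_tile x" "0 \<le> top_depth x" "bot_depth x \<le> total_depth"
      and sub: "\<And>t. top_depth x < t \<Longrightarrow> t < bot_depth x \<Longrightarrow> path_at id t \<le> left_at x t \<and> right_at x t \<le> path_at w t"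
      using T x unfolding tiles_between_def by blast+
    have "interior (rhombus x) \<subseteq> ?X"
    proof
      fix z assume "z \<in> interior (rhombus x)"
      then show "z \<in> ?X" using tile(2,3) sub[of "- Im z"]
        by (simp add: interior_rhombus[OF tile(1)])
    qed
    then have "closure (interior (rhombus x)) \<subseteq> ?X" using closed_X
      by (rule closure_minimal)
    moreover have "convex (rhombus x)" by (auto simp: rhombus_def split: prod.splits)
    then have "closure (interior (rhombus x)) = closure (rhombus x)"
      using convex_closure_interior interior_rhombus_nonempty[OF tile(1)] by blast
    ultimately show ?thesis using closure_subset by blast
  qed
  moreover have "?X \<subseteq> \<Union>(rhombus ` T)"
  proof
    let ?K = "\<Union>(rhombus ` T)"
    have "closed (rhombus x)" for x
      by (cases x) (simp add: rhombus_def compact_imp_closed finite_imp_compact_convex_hull)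
    then have K: "closed ?K" using fin(1) by (intro closed_UN) auto
    have inner: "Complex r (- t) \<in> ?K"
      if t: "0 < t" "t < total_depth" and r: "path_at id t \<le> r" "r \<le> path_at w t" for t r
    proof -
      let ?S = "(\<lambda>r. Complex r (- t)) -` ?K"
      have "closed ?S" using K by (rule closed_vimage) (intro continuous_intros)
      moreover have "{path_at id t<..<path_at w t} \<subseteq> ?S"
      proof
        fix s assume "s \<in> {path_at id t<..<path_at w t}"
        then have "path_at id t < s" "s < path_at w t" by auto
        then obtain x where x: "x \<in> T" "top_depth x \<le> t" "t \<le> bot_depth x" "left_at x t \<le> s" "s \<le> right_at x t"
          using T t unfolding tiles_between_def by blast
        then have "Complex s (- t) \<in> rhombus x" by (simp add: rhombus_eq[OF fin(2)])
        then show "s \<in> ?S" using x(1) by blast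
      qed
      ultimately have "closure {path_at id t<..<path_at w t} \<subseteq> ?S"
        by (rule closure_minimal[rotated])
      moreover have "r \<in> closure {path_at id t<..<path_at w t}"
        using r path_at_id_less[OF n w irred t] by simp
      ultimately show ?thesis by blast
    qed
    have H: "0 < total_depth"
      using depth_strict_mono[OF permutes_id, of 0 n] depth_n[OF permutes_id] n by simp
    \<comment> \<open>At the top and bottom vertices the slice is a single point, reached as a limit
      along the left boundary.\<close>
    have ends: "Complex (path_at id t) (- t) \<in> ?K" if t: "0 \<le> t" "t \<le> total_depth" for t
    proof -
      let ?S = "(\<lambda>t. Complex (path_at id t) (- t)) -` ?K"
      have "closed ?S" using K
        by (rule closed_vimage) (intro continuous_intros continuous_path_at)
      moreover have "{0<..<total_depth} \<subseteq> ?S"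
      proof
        fix s assume "s \<in> {0<..<total_depth}"
        then show "s \<in> ?S" using inner[of s "path_at id s"] path_at_id_le_total[OF n1 w, of s]
          by simp
      qed
      ultimately have "closure {0<..<total_depth} \<subseteq> ?S" by (rule closure_minimal[rotated])
      moreover have "t \<in> closure {0<..<total_depth}" using t H by simp
      ultimately show ?thesis by blast
    qed
    fix z assume z: "z \<in> ?X"
    show "z \<in> ?K"
    proof (cases "0 < - Im z \<and> - Im z < total_depth")
      case True
      then show ?thesis using inner[of "- Im z" "Re z"] z by simp
    next
      case False
      then have t: "- Im z = 0 \<or> - Im z = total_depth" using z by auto
      then have "path_at w (- Im z) = path_at id (- Im z)"
        using path_at_0[OF n1 w] path_at_0[OF n1 permutes_id] path_at_total_depth[OF n1 w]
          path_at_total_depth[OF n1 permutes_id] by (elim disjE) simp_all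
      then have "Re z = path_at id (- Im z)" using z by simp
      then have "Complex (path_at id (- Im z)) (- (- Im z)) = z" by (simp add: complex_eq_iff)
      then show ?thesis using ends[of "- Im z"] z by simp
    qed
  qed
  ultimately have "\<Union>(rhombus ` T) = elnitsky_polygon n \<theta> w"
    unfolding elnitsky_polygon_eq[OF n1 w] by blast
  moreover have "pairwise (\<lambda>R S. interior R \<inter> interior S = {}) (rhombus ` T)"
  proof (rule pairwiseI)
    fix R S assume "R \<in> rhombus ` T" "S \<in> rhombus ` T" "R \<noteq> S"
    then obtain x y where xy: "x \<in> T" "y \<in> T" "R = rhombus x" "S = rhombus y" "x \<noteq> y"
      by blast
    then have "slices_disjoint x y" using T by (auto simp: tiles_between_def pairwise_def)
    then show "interior R \<inter> interior S = {}" using interiors_disjoint_iff fin(2) xy by blast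
  qed
  moreover have "\<forall>R\<in>rhombus ` T. rhombic_tile n \<theta> R"
    using fin(2) rhombic_tile_iff by blast
  ultimately show ?thesis using fin(1) by (simp add: rhombic_tiling_def)
qed

section \<open>Recognizing perimeter tiles\<close>

lemma path_on_contour:
  assumes u: "u permutes {1..n}" and p: "p \<in> {1..n}" and ij: "i \<in> {1..n}" "j \<in> {1..n}" "i \<noteq> j"
    and range: "- Im a \<le> depth u (p - 1)" "depth u p \<le> - Im a + drop_of i + drop_of j"
    and eq: "\<And>t. depth u (p - 1) < t \<Longrightarrow> t < depth u p \<Longrightarrow> path_at u t = contour a i j t"
  shows "u p = i \<and> depth u (p - 1) = - Im a \<or> u p = j \<and> depth u (p - 1) = - Im a + drop_of i"
proof -
  let ?m = "- Im a + drop_of i"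
  have up: "u p \<in> {1..n}" using perm_in[OF u] p by blast
  have d: "depth u p = depth u (p - 1) + drop_of (u p)" "0 < drop_of (u p)"
    using depth_pred[of p u] p drop_perm_pos[OF u p] by auto
  have 1: "u p = i" if "depth u (p - 1) < ?m"
  proof -
    have "slope i = slope (u p)"
      by (rule path_at_slope[OF u p order_refl, of "min (depth u p) ?m" "Re a + slope i * Im a"])
        (use that d eq contour_first[OF ij(1,2), of a] range in \<open>auto simp: algebra_simps\<close>)
    then show ?thesis using slope_eq_iff[OF ij(1) up] by simp
  qed
  have 2: "u p = j" if "?m < depth u p"
  proof -
    have "slope j = slope (u p)"
      by (rule path_at_slope[OF u p, of "max (depth u (p - 1)) ?m" "depth u p"
            "Re a + slope i * drop_of i + slope j * (Im a - drop_of i)"])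
        (use that d eq contour_second[OF ij(1,2), of a] range in \<open>auto simp: algebra_simps\<close>)
    then show ?thesis using slope_eq_iff[OF ij(2) up] by simp
  qed
  \<comment> \<open>A side with a part above the corner of the contour is \<open>i\<close>, one with
    a part below it is \<open>j\<close>; as \<open>i \<noteq> j\<close>, no side passes the corner.
    The drop of the side then leaves only one possible starting depth.\<close>
  show ?thesis
  proof (cases "depth u (p - 1) < ?m")
    case True
    then have "u p = i" by (rule 1)
    then have "\<not> ?m < depth u p" using 2 ij(3) by blast
    then show ?thesis using \<open>u p = i\<close> d range by auto
  next
    case False
    then have "u p = j" using 2 d by auto
    then show ?thesis using False d range by auto
  qed
qed

text \<open>One notion for both boundaries: \<open>u = id\<close> serves left-perimeter tiles and
  \<open>u = w\<close> right-perimeter ones. The tile spans the depths of the sides \<open>r\<close>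
  and \<open>Suc r\<close>.\<close>

definition touches :: "(nat \<Rightarrow> nat) \<Rightarrow> complex \<times> nat \<times> nat \<Rightarrow> nat \<Rightarrow> bool" where
  "touches u x r \<longleftrightarrow> r \<in> {1..<n} \<and> top_depth x = depth u (r - 1) \<and> bot_depth x = depth u (Suc r) \<and>
     (\<forall>t. top_depth x \<le> t \<longrightarrow> t \<le> bot_depth x \<longrightarrow> left_at x t \<le> path_at u t \<and> path_at u t \<le> right_at x t)"

text \<open>With \<open>min\<close> and \<open>max\<close> in the triple, \<open>i\<close>,
  \<open>j\<close> is the order of edges along the contour in question: the left one if
  \<open>i < j\<close>, the right one if \<open>j < i\<close>.\<close>

lemma touches_if_two_sides:
  assumes u: "u permutes {1..n}" and x: "x = (a, min i j, max i j)" and ij: "i \<in> {1..n}" "j \<in> {1..n}" "i \<noteq> j"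
    and p: "p \<in> {1..n}" "path_side \<theta> u p \<subseteq> rhombus x" and q: "q \<in> {1..n}" "path_side \<theta> u q \<subseteq> rhombus x"
    and pq: "p \<noteq> q"
    and eq: "\<And>t. top_depth x < t \<Longrightarrow> t < bot_depth x \<Longrightarrow> left_at x t \<le> path_at u t \<Longrightarrow>
      path_at u t \<le> right_at x t \<Longrightarrow> path_at u t = contour a i j t"
  obtains r where "touches u x r" "u r = i" "u (Suc r) = j"
proof -
  have tile: "is_tile x" using ij by (auto simp: x is_tile_def min_def max_def)
  have tb: "top_depth x = - Im a" "bot_depth x = - Im a + drop_of i + drop_of j"
    by (auto simp: x top_depth_def bot_depth_def min_def max_def)
  have in_tile: "top_depth x \<le> t \<and> t \<le> bot_depth x \<and> left_at x t \<le> path_at u t \<and> path_at u t \<le> right_at x t"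
    if s: "s \<in> {1..n}" "path_side \<theta> u s \<subseteq> rhombus x" and t: "depth u (s - 1) \<le> t" "t \<le> depth u s" for s t
  proof -
    have "Complex (path_at u t) (- t) \<in> path_side \<theta> u s" using t
      by (simp add: path_side_eq[OF u s(1)])
    then have "Complex (path_at u t) (- t) \<in> rhombus x" using s(2) by blast
    then show ?thesis by (simp add: rhombus_eq[OF tile])
  qed
  have side: "u s = i \<and> depth u (s - 1) = - Im a \<or> u s = j \<and> depth u (s - 1) = - Im a + drop_of i"
    if s: "s \<in> {1..n}" "path_side \<theta> u s \<subseteq> rhombus x" for s
  proof -
    have lt: "depth u (s - 1) < depth u s" using depth_strict_mono[OF u, of "s - 1" s] s(1) by auto
    note ends = in_tile[OF s, of "depth u (s - 1)"] in_tile[OF s, of "depth u s"]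
    show ?thesis
    proof (rule path_on_contour[OF u s(1) ij])
      show "- Im a \<le> depth u (s - 1)" "depth u s \<le> - Im a + drop_of i + drop_of j"
        using ends lt tb by auto
      fix t assume "depth u (s - 1) < t" "t < depth u s"
      then show "path_at u t = contour a i j t" using in_tile[OF s, of t] eq[of t] ends lt by auto
    qed
  qed
  have inj: "u p \<noteq> u q" using permutes_inj[OF u] pq by (auto dest: injD)
  \<comment> \<open>Two different sides carry different labels, so one is the upper and the other
    the lower edge of the contour.\<close>
  obtain r s where rs: "r \<in> {1..n}" "path_side \<theta> u r \<subseteq> rhombus x" "u r = i" "depth u (r - 1) = - Im a"
      "s \<in> {1..n}" "path_side \<theta> u s \<subseteq> rhombus x" "u s = j" "depth u (s - 1) = - Im a + drop_of i"
    using side[OF p] side[OF q] inj p q by metis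
  have dr: "depth u r = - Im a + drop_of i" using depth_pred[of r u] rs by auto
  then have "s - 1 = r" using depth_eq_iff[OF u, of "s - 1" r] rs by auto
  then have s: "s = Suc r" using rs by auto
  have "left_at x t \<le> path_at u t \<and> path_at u t \<le> right_at x t"
    if "top_depth x \<le> t" "t \<le> bot_depth x" for t
    using in_tile[OF rs(1,2), of t] in_tile[OF rs(5,6), of t] that dr tb rs s
    by (cases "t \<le> depth u r") (auto simp: depth_Suc)
  then have "touches u x r" unfolding touches_def using tb rs s dr by (auto simp: depth_Suc)
  with that rs s show ?thesis by blast
qed

text \<open>All tiles lie right of the path of the identity, so where that path enters the tile it
  must follow the left contour. Consecutive sides of this path have consecutive labels.\<close>

lemma left_perimeter_touches:
  assumes T: "tiles_between T id w" "x \<in> T" and L: "left_perimeter_tile n \<theta> (rhombus x)"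
  obtains a r where "touches id x r" "x = (a, r, Suc r)"
proof -
  obtain a i j where x: "x = (a, i, j)" by (cases x)
  have ij: "i \<in> {1..n}" "j \<in> {1..n}" "i < j" using T
    by (auto simp: tiles_between_def x is_tile_def)
  obtain p q where pq: "p \<in> {1..n}" "q \<in> {1..n}" "p \<noteq> q" "path_side \<theta> id p \<subseteq> rhombus x" "path_side \<theta> id q \<subseteq> rhombus x"
    using L unfolding left_perimeter_tile_def left_side_def by blast
  have x': "x = (a, min i j, max i j)" using ij x by simp
  have eq: "path_at id t = contour a i j t"
    if "top_depth x < t" "t < bot_depth x" "left_at x t \<le> path_at id t" for t
  proof -
    have "path_at id t \<le> left_at x t" using T that unfolding tiles_between_def by blast
    then show ?thesis using that x by (simp add: left_at_def)
  qed
  obtain r where "touches id x r" "id r = i" "id (Suc r) = j"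
    using touches_if_two_sides[OF permutes_id x' ij(1,2) _ pq(1,4,2,5,3) eq] ij(3) by auto
  with x have "x = (a, r, Suc r)" by simp
  with that \<open>touches id x r\<close> show ?thesis by blast
qed

lemma right_perimeter_touches:
  assumes w: "w permutes {1..n}" and T: "tiles_between T u w" "x \<in> T"
    and R: "right_perimeter_tile n \<theta> w (rhombus x)"
  obtains a r where "touches w x r" "x = (a, w (Suc r), w r)"
proof -
  obtain a i j where x: "x = (a, i, j)" by (cases x)
  have ij: "i \<in> {1..n}" "j \<in> {1..n}" "i < j" using T
    by (auto simp: tiles_between_def x is_tile_def)
  obtain p q where pq: "p \<in> {1..n}" "q \<in> {1..n}" "p \<noteq> q" "path_side \<theta> w p \<subseteq> rhombus x" "path_side \<theta> w q \<subseteq> rhombus x"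
    using R unfolding right_perimeter_tile_def right_side_def by blast
  have x': "x = (a, min j i, max j i)" using ij x by simp
  have eq: "path_at w t = contour a j i t"
    if "top_depth x < t" "t < bot_depth x" "path_at w t \<le> right_at x t" for t
  proof -
    have "right_at x t \<le> path_at w t" using T that unfolding tiles_between_def by blast
    then show ?thesis using that x by (simp add: right_at_def)
  qed
  obtain r where "touches w x r" "w r = j" "w (Suc r) = i"
    using touches_if_two_sides[OF w x' ij(2,1) _ pq(1,4,2,5,3) eq] ij(3) by auto
  with x have "x = (a, w (Suc r), w r)" by simp
  with that \<open>touches w x r\<close> show ?thesis by blast
qed

lemma perimeter_path_tile:
  assumes u: "u permutes {1..n}" and p: "p \<in> {1..<n}" and asc: "u p < u (Suc p)"
  shows "path_side \<theta> u p \<subseteq> rhombus (path_tile u p)" "path_side \<theta> u (Suc p) \<subseteq> rhombus (path_tile u p)"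
    and "right_perimeter_tile n \<theta> (swap_at u p) (rhombus (path_tile u p))"
proof -
  let ?x = "path_tile u p" and ?v = "swap_at u p"
  note tile = is_tile_path_tile[OF u p asc]
  have v: "?v permutes {1..n}" using swap_at_permutes[OF u p] .
  have depths: "depth ?v (p - 1) = depth u (p - 1)" "depth ?v (Suc p) = depth u (Suc p)"
    using depth_swap_at[of "p - 1" p u] depth_swap_at[of "Suc p" p u] p by auto
  note tb = top_path_tile[OF u p asc] bot_path_tile[OF u p asc]
  have side: "path_side \<theta> y s \<subseteq> rhombus ?x"
    if y: "y permutes {1..n}" "y = u \<or> y = ?v" and s: "s \<in> {p, Suc p}" for y s
  proof
    fix z assume z: "z \<in> path_side \<theta> y s"
    have sn: "s \<in> {1..n}" using s p by auto
    have "depth y (p - 1) \<le> depth y (s - 1)" "depth y s \<le> depth y (Suc p)"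
      using depth_mono[OF y(1), of "p - 1" "s - 1"] depth_mono[OF y(1), of s "Suc p"] s p by auto
    then have t: "top_depth ?x \<le> - Im z" "- Im z \<le> bot_depth ?x" and re: "Re z = path_at y (- Im z)"
      using z y(2) depths tb unfolding path_side_eq[OF y(1) sn] by auto
    show "z \<in> rhombus ?x" unfolding rhombus_eq[OF tile] mem_Collect_eq
      using t re y(2) left_path_tile[OF u p asc t] right_path_tile[OF u p asc t] left_le_right[OF tile t] by auto
  qed
  show "path_side \<theta> u p \<subseteq> rhombus ?x" "path_side \<theta> u (Suc p) \<subseteq> rhombus ?x"
    using side[OF u] by auto
  show "right_perimeter_tile n \<theta> ?v (rhombus ?x)"
    unfolding right_perimeter_tile_def right_side_def
    using side[OF v, of p] side[OF v, of "Suc p"] p by (intro bexI[of _ p] bexI[of _ "Suc p"]) auto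
qed

lemma left_perimeter_path_tile: "p \<in> {1..<n} \<Longrightarrow> left_perimeter_tile n \<theta> (rhombus (path_tile id p))"
  using perimeter_path_tile(1,2)[OF permutes_id, of p]
  unfolding left_perimeter_tile_def left_side_def
  by (intro bexI[of _ p] bexI[of _ "Suc p"]) auto

lemma swap_at_swap_at [simp]: "swap_at (swap_at u p) p = u"
  by (simp add: o_assoc[symmetric])

lemma right_perimeter_path_tile:
  assumes "w permutes {1..n}" "p \<in> {1..<n}" "w (Suc p) < w p"
  shows "right_perimeter_tile n \<theta> w (rhombus (path_tile (swap_at w p) p))"
  using perimeter_path_tile(3)[OF swap_at_permutes[OF assms(1,2)] assms(2)] assms(3) by simp

text \<open>At equal or adjacent positions both tiles span the side \<open>q\<close>. At a depth on
  that side, both slices begin, or both end, on the path, so they overlap. The assumption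
  \<open>same\<close> says that both tiles lie on the same side of the path.\<close>

lemma touching_tiles_eq:
  assumes u: "u permutes {1..n}" and xy: "is_tile x" "is_tile y" "x \<noteq> y \<Longrightarrow> slices_disjoint x y"
    and touch: "touches u x p" "touches u y q" and "p \<le> q" "q \<le> Suc p"
    and same: "(\<forall>t z. z \<in> {x, y} \<longrightarrow> top_depth z < t \<longrightarrow> t < bot_depth z \<longrightarrow> path_at u t \<le> left_at z t) \<or>
      (\<forall>t z. z \<in> {x, y} \<longrightarrow> top_depth z < t \<longrightarrow> t < bot_depth z \<longrightarrow> right_at z t \<le> path_at u t)"
  shows "x = y"
proof (rule ccontr)
  assume "x \<noteq> y"
  have pq: "p \<in> {1..<n}" "q \<in> {1..<n}" using touch by (auto simp: touches_def)
  obtain t where t: "depth u (q - 1) < t" "t < depth u q"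
    using dense[OF depth_strict_mono[OF u, of "q - 1" q]] pq by auto
  have "depth u (p - 1) \<le> depth u (q - 1)" "depth u q \<le> depth u (Suc p)" "depth u q \<le> depth u (Suc q)"
    using depth_mono[OF u, of "p - 1" "q - 1"] depth_mono[OF u, of q "Suc p"] depth_mono[OF u, of q "Suc q"]
      pq assms(7,8) by auto
  then have r: "top_depth x < t" "t < bot_depth x" "top_depth y < t" "t < bot_depth y"
    using touch t by (auto simp: touches_def)
  have "left_at x t \<le> path_at u t" "path_at u t \<le> right_at x t"
    "left_at y t \<le> path_at u t" "path_at u t \<le> right_at y t"
    using touch r by (auto simp: touches_def)
  moreover have "right_at x t \<le> left_at y t \<or> right_at y t \<le> left_at x t"
    using xy(3)[OF \<open>x \<noteq> y\<close>] r by (simp add: slices_disjoint_def)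
  moreover have "(path_at u t \<le> left_at x t \<and> path_at u t \<le> left_at y t) \<or>
      (right_at x t \<le> path_at u t \<and> right_at y t \<le> path_at u t)"
    using same r by blast
  ultimately show False using left_less_right[OF xy(1) r(1,2)] left_less_right[OF xy(2) r(3,4)]
    by linarith
qed

section \<open>Counting side-perimeter tiles\<close>

context
  fixes w assumes n: "2 < n" and w: "w permutes {1..n}"
    and irred: "\<forall>r\<in>{1..<n}. w ` {1..r} \<noteq> {1..r}"
begin

lemma nontrivial: "w \<noteq> id"
  using bspec[OF irred, of 1] n by auto

text \<open>The top and bottom vertices of such a tile would lie on both boundaries, which meet only
  at the ends of the polygon. The tile would span the total depth with two sides, so
  \<open>n = 2\<close>.\<close>

lemma not_left_and_right_perimeter:
  assumes T: "tiles_between T id w" "x \<in> T"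
    and "left_perimeter_tile n \<theta> (rhombus x)" "right_perimeter_tile n \<theta> w (rhombus x)"
  shows False
proof -
  have tile: "is_tile x" using T unfolding tiles_between_def by blast
  obtain r where r: "touches id x r" using left_perimeter_touches[OF T assms(3)] by blast
  obtain s where s: "touches w x s" using right_perimeter_touches[OF w T assms(4)] by blast
  have range: "0 \<le> top_depth x" "bot_depth x \<le> total_depth" "top_depth x < bot_depth x"
    using T top_less_bot[OF tile] unfolding tiles_between_def by blast+
  have touch: "left_at x t \<le> path_at u t \<and> path_at u t \<le> right_at x t"
    if "touches u x k" "top_depth x \<le> t" "t \<le> bot_depth x" for u k t
    using that by (simp add: touches_def)
  have "path_at id (top_depth x) = path_at w (top_depth x)"
    using touch[OF r, of "top_depth x"] touch[OF s, of "top_depth x"] left_right_top[OF tile] range(3) by simp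
  then have "\<not> (0 < top_depth x \<and> top_depth x < total_depth)"
    using path_at_id_less[OF _ w irred, of "top_depth x"] n by auto
  then have top: "top_depth x = 0" using range by linarith
  have "path_at id (bot_depth x) = path_at w (bot_depth x)"
    using touch[OF r, of "bot_depth x"] touch[OF s, of "bot_depth x"] left_right_bot[OF tile] range(3) by simp
  then have "\<not> (0 < bot_depth x \<and> bot_depth x < total_depth)"
    using path_at_id_less[OF _ w irred, of "bot_depth x"] n by auto
  then have bot: "bot_depth x = total_depth" using range by linarith
  have "r - 1 = 0" using depth_eq_iff[OF permutes_id, of "r - 1" 0] top r
    by (auto simp: touches_def)
  moreover have "Suc r = n"
    using depth_eq_iff[OF permutes_id, of "Suc r" n] depth_n[OF permutes_id] bot r
    by (auto simp: touches_def)
  ultimately show False using n by simp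
qed

lemma exists_left_perimeter_tile:
  assumes T: "tiles_between T id w"
  shows "\<exists>x\<in>T. left_perimeter_tile n \<theta> (rhombus x)"
proof -
  have "T \<noteq> {}" using tiles_between_empty[OF permutes_id w] T nontrivial by blast
  then obtain p where "p \<in> {1..<n}" "path_tile id p \<in> T"
    using exists_flippable_leftmost_tile[OF permutes_id T] by blast
  then show ?thesis using left_perimeter_path_tile by blast
qed

lemma exists_right_perimeter_tile:
  assumes T: "tiles_between T id w"
  shows "\<exists>x\<in>T. right_perimeter_tile n \<theta> w (rhombus x)"
proof -
  have "T \<noteq> {}" using tiles_between_empty[OF permutes_id w] T nontrivial by blast
  then show ?thesis
    using tiles_between_structure(3)[OF permutes_id w T] right_perimeter_path_tile[OF w] by blast
qed

text \<open>The labels \<open>p\<close>, \<open>Suc p\<close> of a left-perimeter tile form an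
  inversion of \<open>w\<close>, that is, \<open>p\<close> is a descent of \<open>inv w\<close>.
  Clustering makes the positions of two such tiles equal or adjacent.\<close>

lemma left_perimeter_tile_unique:
  assumes cl: "clustered_descents n (inv w)" and T: "tiles_between T id w" and xy: "x \<in> T" "y \<in> T"
    and L: "left_perimeter_tile n \<theta> (rhombus x)" "left_perimeter_tile n \<theta> (rhombus y)"
  shows "x = y"
proof -
  obtain a p where p: "touches id x p" "x = (a, p, Suc p)"
    using left_perimeter_touches[OF T xy(1) L(1)] by blast
  obtain b q where q: "touches id y q" "y = (b, q, Suc q)"
    using left_perimeter_touches[OF T xy(2) L(2)] by blast
  have "(p, Suc p) \<in> inversions w" "(q, Suc q) \<in> inversions w"
    using tiles_between_structure(2)[OF permutes_id w T] p(2) q(2) xy by blast+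
  moreover have pq: "p \<in> {1..<n}" "q \<in> {1..<n}" using p(1) q(1) by (auto simp: touches_def)
  ultimately have near: "q \<le> Suc p" "p \<le> Suc q"
    using cl by (auto simp: clustered_descents_def inversions_def)
  have tiles: "is_tile x" "is_tile y" using T xy unfolding tiles_between_def by blast+
  have disj: "x \<noteq> y \<Longrightarrow> slices_disjoint x y" "y \<noteq> x \<Longrightarrow> slices_disjoint y x"
    using T xy unfolding tiles_between_def pairwise_def by blast+
  have "\<forall>t z. z \<in> {x, y} \<longrightarrow> top_depth z < t \<longrightarrow> t < bot_depth z \<longrightarrow> path_at id t \<le> left_at z t"
    "\<forall>t z. z \<in> {y, x} \<longrightarrow> top_depth z < t \<longrightarrow> t < bot_depth z \<longrightarrow> path_at id t \<le> left_at z t"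
    using T xy unfolding tiles_between_def by blast+
  note same = disjI1[OF this(1)] disjI1[OF this(2)]
  show ?thesis
  proof (cases "p \<le> q")
    case True
    show ?thesis by (rule touching_tiles_eq[OF permutes_id tiles disj(1) p(1) q(1) True near(1) same(1)])
  next
    case False
    then have "q \<le> p" by simp
    then show ?thesis
      using touching_tiles_eq[OF permutes_id tiles(2,1) disj(2) q(1) p(1) _ near(2) same(2)]
      by blast
  qed
qed

text \<open>Here the descent of \<open>w\<close> is immediate, since the labels of a tile are listed
  in increasing order.\<close>

lemma right_perimeter_tile_unique:
  assumes cl: "clustered_descents n w" and T: "tiles_between T id w" and xy: "x \<in> T" "y \<in> T"
    and R: "right_perimeter_tile n \<theta> w (rhombus x)" "right_perimeter_tile n \<theta> w (rhombus y)"
  shows "x = y"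
proof -
  obtain a p where p: "touches w x p" "x = (a, w (Suc p), w p)"
    using right_perimeter_touches[OF w T xy(1) R(1)] by blast
  obtain b q where q: "touches w y q" "y = (b, w (Suc q), w q)"
    using right_perimeter_touches[OF w T xy(2) R(2)] by blast
  have tiles: "is_tile x" "is_tile y" using T xy unfolding tiles_between_def by blast+
  then have "w (Suc p) < w p" "w (Suc q) < w q" using p(2) q(2) by (auto simp: is_tile_def)
  moreover have pq: "p \<in> {1..<n}" "q \<in> {1..<n}" using p(1) q(1) by (auto simp: touches_def)
  ultimately have near: "q \<le> Suc p" "p \<le> Suc q" using cl
    by (auto simp: clustered_descents_def)
  have disj: "x \<noteq> y \<Longrightarrow> slices_disjoint x y" "y \<noteq> x \<Longrightarrow> slices_disjoint y x"
    using T xy unfolding tiles_between_def pairwise_def by blast+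
  have "\<forall>t z. z \<in> {x, y} \<longrightarrow> top_depth z < t \<longrightarrow> t < bot_depth z \<longrightarrow> right_at z t \<le> path_at w t"
    "\<forall>t z. z \<in> {y, x} \<longrightarrow> top_depth z < t \<longrightarrow> t < bot_depth z \<longrightarrow> right_at z t \<le> path_at w t"
    using T xy unfolding tiles_between_def by blast+
  note same = disjI2[OF this(1)] disjI2[OF this(2)]
  show ?thesis
  proof (cases "p \<le> q")
    case True
    show ?thesis by (rule touching_tiles_eq[OF w tiles disj(1) p(1) q(1) True near(1) same(1)])
  next
    case False
    then have "q \<le> p" by simp
    then show ?thesis
      using touching_tiles_eq[OF w tiles(2,1) disj(2) q(1) p(1) _ near(2) same(2)] by blast
  qed
qed

lemma two_perimeter_tiles_if_clustered:
  assumes cl: "clustered_descents n w" "clustered_descents n (inv w)" and T: "rhombic_tiling n \<theta> w T"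
  shows "card (side_perimeter_tiles n \<theta> w T) = 2"
proof -
  obtain T' where T': "tiles_between T' id w" "T = rhombus ` T'"
    using tiles_between_if_rhombic_tiling[OF _ w T] n by auto
  obtain x where x: "x \<in> T'" "left_perimeter_tile n \<theta> (rhombus x)"
    using exists_left_perimeter_tile[OF T'(1)] by blast
  obtain y where y: "y \<in> T'" "right_perimeter_tile n \<theta> w (rhombus y)"
    using exists_right_perimeter_tile[OF T'(1)] by blast
  have "side_perimeter_tiles n \<theta> w T = {rhombus x, rhombus y}"
    unfolding side_perimeter_tiles_def T'(2)
    using x y left_perimeter_tile_unique[OF cl(2) T'(1) x(1) _ x(2)]
      right_perimeter_tile_unique[OF cl(1) T'(1) y(1) _ y(2)] by blast
  moreover have "rhombus x \<noteq> rhombus y"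
    using not_left_and_right_perimeter[OF T'(1) x(1,2)] y(2) by auto
  ultimately show ?thesis by simp
qed

lemma many_perimeter_tiles:
  assumes T: "tiles_between T id w" and xyz: "x \<in> T" "y \<in> T" "z \<in> T" "x \<noteq> y"
    and per: "left_perimeter_tile n \<theta> (rhombus x) \<and> left_perimeter_tile n \<theta> (rhombus y) \<and>
        right_perimeter_tile n \<theta> w (rhombus z) \<or>
      right_perimeter_tile n \<theta> w (rhombus x) \<and> right_perimeter_tile n \<theta> w (rhombus y) \<and>
        left_perimeter_tile n \<theta> (rhombus z)"
  shows "\<exists>T. rhombic_tiling n \<theta> w T \<and> card (side_perimeter_tiles n \<theta> w T) \<noteq> 2"
proof -
  let ?P = "side_perimeter_tiles n \<theta> w (rhombus ` T)"
  have tiling: "rhombic_tiling n \<theta> w (rhombus ` T)"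
    using rhombic_tiling_if_tiles_between[OF _ w irred T] n by simp
  have "x \<noteq> z" "y \<noteq> z" using per xyz not_left_and_right_perimeter[OF T] by blast+
  then have "card (rhombus ` {x, y, z}) = 3"
    using xyz by (subst card_image[OF inj_on_subset[OF inj_on_rhombus[OF T]]]) auto
  moreover have "rhombus ` {x, y, z} \<subseteq> ?P" using per xyz
    unfolding side_perimeter_tiles_def by blast
  moreover have "finite ?P" using tiling by (simp add: rhombic_tiling_def side_perimeter_tiles_def)
  ultimately have "3 \<le> card ?P" using card_mono by metis
  then show ?thesis using tiling by (intro exI[of _ "rhombus ` T"]) simp
qed

text \<open>Exchanges at non-adjacent positions commute: the first does not move the sides or the
  vertex used by the second. Both tiles thus lie along the left boundary, and the chain they begin
  can be completed to \<open>w\<close> because it has created only inversions of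
  \<open>w\<close>.\<close>

lemma many_perimeter_tiles_if_left_descents:
  assumes pq: "p \<in> {1..<n}" "q \<in> {1..<n}" "Suc p < q"
    and "inv w (Suc p) < inv w p" "inv w (Suc q) < inv w q"
  shows "\<exists>T. rhombic_tiling n \<theta> w T \<and> card (side_perimeter_tiles n \<theta> w T) \<noteq> 2"
proof -
  let ?u = "swap_at id p"
  have u: "?u permutes {1..n}" by (rule swap_at_permutes[OF permutes_id pq(1)])
  have uq: "?u q = q" "?u (Suc q) = Suc q" using pq(3) by (auto simp: Transposition.transpose_def)
  then have asc: "?u q < ?u (Suc q)" by simp
  let ?v = "swap_at ?u q"
  have "inversions ?v = {(q, Suc q), (p, Suc p)}"
    using inversions_swap_at(1)[OF u pq(2) asc] inversions_swap_at(1)[OF permutes_id pq(1)] uq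
    by simp
  then have "inversions ?v \<subseteq> inversions w" using assms by (auto simp: inversions_def)
  then obtain T0 where T0: "tiles_between T0 ?v w"
    using exists_tiles_between[OF swap_at_permutes[OF u pq(2)] w] by blast
  have "tiles_between {path_tile id p} id ?u" using tiles_between_single[OF permutes_id pq(1)]
    by simp
  then have T: "tiles_between ({path_tile id p} \<union> ({path_tile ?u q} \<union> T0)) id w"
    (is "tiles_between ?T id w")
    using tiles_between_append tiles_between_single[OF u pq(2) asc] T0 by blast
  have "path_tile ?u q = path_tile id q"
    using path_vertex_swap_at[of "q - 1" p id] pq uq by (simp add: path_tile_def)
  then have mem: "path_tile id p \<in> ?T" "path_tile id q \<in> ?T" by auto
  obtain z where z: "z \<in> ?T" "right_perimeter_tile n \<theta> w (rhombus z)"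
    using exists_right_perimeter_tile[OF T] by blast
  have "path_tile id p \<noteq> path_tile id q" using pq(3) by (simp add: path_tile_def)
  with many_perimeter_tiles[OF T mem z(1)] z(2) left_perimeter_path_tile pq(1,2) show ?thesis
    by blast
qed

text \<open>The chain is built backwards: both descents are undone, the resulting permutation is
  reached from the identity, and the two tiles close the chain, each along the path of
  \<open>w\<close>.\<close>

lemma many_perimeter_tiles_if_right_descents:
  assumes pq: "p \<in> {1..<n}" "q \<in> {1..<n}" "Suc p < q"
    and desc: "w (Suc p) < w p" "w (Suc q) < w q"
  shows "\<exists>T. rhombic_tiling n \<theta> w T \<and> card (side_perimeter_tiles n \<theta> w T) \<noteq> 2"
proof -
  let ?v = "swap_at w p"
  have v: "?v permutes {1..n}" by (rule swap_at_permutes[OF w pq(1)])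
  let ?u = "swap_at ?v q"
  have u: "?u permutes {1..n}" by (rule swap_at_permutes[OF v pq(2)])
  have vp: "?v p < ?v (Suc p)" using desc(1) by simp
  have uq: "?u q = w (Suc q)" "?u (Suc q) = w q" using pq(3)
    by (auto simp: Transposition.transpose_def)
  then have asc: "?u q < ?u (Suc q)" using desc(2) by simp
  obtain T0 where T0: "tiles_between T0 id ?u"
    using exists_tiles_between[OF permutes_id u] by auto
  have "tiles_between {path_tile ?u q} ?u ?v" using tiles_between_single[OF u pq(2) asc]
    unfolding swap_at_swap_at .
  moreover have "tiles_between {path_tile ?v p} ?v w" using tiles_between_single[OF v pq(1) vp]
    unfolding swap_at_swap_at .
  ultimately have T: "tiles_between (T0 \<union> ({path_tile ?u q} \<union> {path_tile ?v p})) id w"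
    (is "tiles_between ?T id w")
    using tiles_between_append T0 by blast
  have "path_vertex \<theta> ?u (q - 1) = path_vertex \<theta> w (q - 1)"
    using path_vertex_swap_at[of "q - 1" q ?v] path_vertex_swap_at[of "q - 1" p w] pq by auto
  then have "path_tile ?u q = path_tile (swap_at w q) q"
    using path_vertex_swap_at[of "q - 1" q w] pq uq by (simp add: path_tile_def)
  then have mem: "path_tile (swap_at w p) p \<in> ?T" "path_tile (swap_at w q) q \<in> ?T" by auto
  obtain z where z: "z \<in> ?T" "left_perimeter_tile n \<theta> (rhombus z)"
    using exists_left_perimeter_tile[OF T] by blast
  have "w p \<noteq> w q" using inj_eq[OF permutes_inj[OF w]] pq(3) by simp
  then have "path_tile (swap_at w p) p \<noteq> path_tile (swap_at w q) q"
    by (simp add: path_tile_def)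
  with many_perimeter_tiles[OF T mem z(1)] z(2) right_perimeter_path_tile[OF w] pq(1,2) desc
  show ?thesis by blast
qed

theorem two_perimeter_tiles_iff_clustered:
  "(\<forall>T. rhombic_tiling n \<theta> w T \<longrightarrow> card (side_perimeter_tiles n \<theta> w T) = 2) \<longleftrightarrow>
    clustered_descents n w \<and> clustered_descents n (inv w)"
proof
  assume two: "\<forall>T. rhombic_tiling n \<theta> w T \<longrightarrow> card (side_perimeter_tiles n \<theta> w T) = 2"
  have "q \<le> Suc p"
    if "p \<in> {1..<n}" "q \<in> {1..<n}" "w (Suc p) < w p" "w (Suc q) < w q" for p q
    using many_perimeter_tiles_if_right_descents[OF that(1,2) _ that(3,4)] two not_le by blast
  moreover have "q \<le> Suc p"
    if "p \<in> {1..<n}" "q \<in> {1..<n}" "inv w (Suc p) < inv w p" "inv w (Suc q) < inv w q"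
      for p q
    using many_perimeter_tiles_if_left_descents[OF that(1,2) _ that(3,4)] two not_le by blast
  ultimately show "clustered_descents n w \<and> clustered_descents n (inv w)"
    unfolding clustered_descents_def by blast
qed (use two_perimeter_tiles_if_clustered in blast)

end

end

theorem theorem4p6:
  fixes n :: nat and w :: "nat \<Rightarrow> nat" and \<theta> :: "nat \<Rightarrow> real"
  assumes "n > 2"
    and "w permutes {1..n}"
    and "\<forall>r\<in>{1..<n}. w ` {1..r} \<noteq> {1..r}"
    and "half_convex_polygon n \<theta>"
  shows "(\<forall>T. rhombic_tiling n \<theta> w T \<longrightarrow> card (side_perimeter_tiles n \<theta> w T) = 2) \<longleftrightarrow>
    (\<exists>k\<in>{1..n - 1}.
       one_line n w = [k + 1..<n + 1] @ [1..<k + 1] \<or>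
       one_line n w = [k + 1..<n + 1] @ [k] @ [1..<k])"
proof -
  interpret elnitsky n \<theta> using assms(4) by unfold_locales
  have "2 \<le> n" using assms(1) by simp
  have "clustered_descents n w \<and> clustered_descents n (inv w) \<longleftrightarrow>
    (\<exists>k\<in>{1..n - 1}.
       one_line n w = [k + 1..<n + 1] @ [1..<k + 1] \<or>
       one_line n w = [k + 1..<n + 1] @ [k] @ [1..<k])"
    using clustered_descents_imp_form[OF \<open>2 \<le> n\<close> assms(2,3)] form_imp_clustered_descents[OF assms(2)]
      one_line_forms[of _ n w] by blast
  then show ?thesis using two_perimeter_tiles_iff_clustered[OF assms(1-3)] by simp
qed

end
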